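(* Let $n,m,b,k\in\mathbb{Z}$ with $n\ge 3$, $|m|\ge 2$, $b\ge 2$ and $k\ge 2$. Assume that $\gcd(b,m)=1$, that $b$ is squarefree, and that $m\equiv 0\pmod{\mathrm{rad}(k)}$. Let $$\mathcal{D}:=\frac{n^n(1-bm^{2n})^{n+1}+bm^{2n}(n+1)^{n+1}}{(1+bm^{2n}n)^2}\in\mathbb{Z},$$ and assume that $$d:=\frac{|\mathcal{D}|}{\prod_{p\text{ prime},\ p\mid bm}p^{\nu_p(\mathcal{D})}}$$ is squarefree. Assume further that, for every prime divisor $p$ of $k$, the polynomial $$g_p(x):=x^{nk/p^{\nu_p(k)}}+b$$ is irreducible in $\mathbb{F}_p[x]$. Let $$\mathcal{F}_{n,b,m,k}(x):=x^{nk}+b\sum_{j=1}^{n}(m^2x^k)^{n-j}.$$ Then $\mathcal{F}_{n,b,m,k}(x)$ is monogenic if and only if both of the following hold: (1) no odd prime divisor of $k\gcd(n,m)$ is a base-$b$ Wieferich prime; and (2) if $k\gcd(n,m)\equiv 0\pmod 2$, then $b\equiv 1\pmod 4$ (equivalently, $2$ is a base-$b$ Wieferich prime).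
   Context: For an integer $b\ge 2$, a prime $p\ge 2$ is called a base-$b$ Wieferich prime if $b^{p-1}\equiv 1\pmod{p^2}$. A monic polynomial $f(x)\in\mathbb{Z}[x]$ is called monogenic if $f(x)$ is irreducible over $\mathbb{Q}$ and $\{1,\theta,\theta^2,\ldots,\theta^{\deg(f)-1}\}$ is a basis (over $\mathbb{Z}$) for the ring of integers of $\mathbb{Q}(\theta)$, where $f(\theta)=0$. Here $\mathrm{rad}(k)$ is the product of the distinct prime divisors of $k$, and $\nu_p(z)$ denotes the $p$-adic valuation of the integer $z$. The quantity $\mathcal{D}$ is always an integer. In the sum, the term $j=n$ is $(m^2x^k)^0=1$. *)

theory Defs
  imports
    Complex_Main
    "HOL-Computational_Algebra.Computational_Algebra"
    "HOL-Number_Theory.Cong"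
    "Berlekamp_Zassenhaus.Poly_Mod"
begin

definition wieferich_prime :: "int \<Rightarrow> nat \<Rightarrow> bool" where
  "wieferich_prime b p \<longleftrightarrow> prime p \<and> [b ^ (p - 1) = 1] (mod (int p)\<^sup>2)"

lemma wieferich_prime_2: "wieferich_prime b 2 \<longleftrightarrow> [b = 1] (mod 4)"
  by (simp add: wieferich_prime_def)

definition rad :: "nat \<Rightarrow> nat" where
  "rad k = \<Prod>(prime_factors k)"

text \<open>The field generated by \<open>\<theta>\<close> over the rationals, as the least subfield of the complex numbers
  containing \<open>\<theta>\<close>. Closure under division by zero is harmless since \<open>x / 0 = 0\<close>.\<close>

definition rat_adjoin :: "complex \<Rightarrow> complex set" where
  "rat_adjoin \<theta> = \<Inter>{K. \<theta> \<in> K \<and> 0 \<in> K \<and> 1 \<in> K \<and>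
     (\<forall>x\<in>K. \<forall>y\<in>K. x + y \<in> K \<and> x - y \<in> K \<and> x * y \<in> K \<and> x / y \<in> K)}"

definition ring_of_integers :: "complex set \<Rightarrow> complex set" where
  "ring_of_integers K = {z \<in> K. algebraic_int z}"

definition int_basis :: "nat \<Rightarrow> (nat \<Rightarrow> complex) \<Rightarrow> complex set \<Rightarrow> bool" where
  "int_basis d v M \<longleftrightarrow>
     M = {\<Sum>i<d. of_int (c i) * v i | c :: nat \<Rightarrow> int. True} \<and>
     (\<forall>c :: nat \<Rightarrow> int. (\<Sum>i<d. of_int (c i) * v i) = 0 \<longrightarrow> (\<forall>i<d. c i = 0))"

text \<open>The basis condition is required of every complex root; for \<open>f\<close> irreducible over the
  rationals the roots are conjugate, so requiring it of one root would be the same.\<close>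

definition monogenic :: "int poly \<Rightarrow> bool" where
  "monogenic f \<longleftrightarrow>
     lead_coeff f = 1 \<and>
     irreducible (map_poly rat_of_int f) \<and>
     (\<forall>\<theta> :: complex. poly (map_poly of_int f) \<theta> = 0 \<longrightarrow>
        int_basis (degree f) (\<lambda>i. \<theta> ^ i) (ring_of_integers (rat_adjoin \<theta>)))"

definition poly_F :: "nat \<Rightarrow> int \<Rightarrow> int \<Rightarrow> nat \<Rightarrow> int poly" where
  "poly_F n b m k = monom 1 (n * k) + smult b (\<Sum>j=1..n. (monom (m\<^sup>2) k) ^ (n - j))"

text \<open>Irreducibility in the polynomial ring over the field with \<open>p\<close> elements is
  \<^const>\<open>poly_mod.irreducible_m\<close> at the modulus \<open>p\<close>, applied to an integer representative.\<close>

definition poly_g :: "nat \<Rightarrow> int \<Rightarrow> nat \<Rightarrow> nat \<Rightarrow> int poly" where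
  "poly_g n b k p = monom 1 (n * (k div p ^ multiplicity p k)) + [:b:]"

text \<open>Both integer divisions below are exact, see \<open>of_int_\<D>\<close> and \<open>of_int_reduced_\<D>\<close>.\<close>

definition \<D> :: "nat \<Rightarrow> int \<Rightarrow> int \<Rightarrow> int" where
  "\<D> n b m =
     (int n ^ n * (1 - b * m ^ (2 * n)) ^ (n + 1) + b * m ^ (2 * n) * (int n + 1) ^ (n + 1))
     div (1 + b * m ^ (2 * n) * int n)\<^sup>2"

definition reduced_\<D> :: "nat \<Rightarrow> int \<Rightarrow> int \<Rightarrow> int" where
  "reduced_\<D> n b m =
     \<bar>\<D> n b m\<bar> div (\<Prod>p \<in> {p. prime p \<and> p dvd b * m}. p ^ multiplicity p (\<D> n b m))"

lemma \<D>_denominator_dvd: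
  fixes B :: int
  assumes "n \<ge> 1"
  shows "(1 + B * int n)\<^sup>2 dvd int n ^ n * (1 - B) ^ (n + 1) + B * (int n + 1) ^ (n + 1)"
    (is "?u\<^sup>2 dvd ?N")
proof -
  have pow: "u\<^sup>2 dvd (a - u) ^ (j + 1) - (a ^ (j + 1) - int (j + 1) * u * a ^ j)" for u a :: int and j
  proof (induction j)
    case 0
    then show ?case by simp
  next
    case (Suc j)
    have "(a - u) ^ (Suc j + 1) - (a ^ (Suc j + 1) - int (Suc j + 1) * u * a ^ Suc j) =
      (a - u) * ((a - u) ^ (j + 1) - (a ^ (j + 1) - int (j + 1) * u * a ^ j))
        + u\<^sup>2 * (int (j + 1) * a ^ j)"
      by (simp add: algebra_simps power2_eq_square)
    with Suc show ?case by (metis dvd_add dvd_mult dvd_triv_left)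
  qed
  have "int n * ?N = (int n + 1 - ?u) ^ (n + 1) + int n * B * (int n + 1) ^ (n + 1)"
    by (simp add: power_mult_distrib[symmetric] algebra_simps)
  also have "\<dots> = (int n + 1 - ?u) ^ (n + 1)
      - ((int n + 1) ^ (n + 1) - int (n + 1) * ?u * (int n + 1) ^ n)"
    by (simp add: algebra_simps)
  finally have "?u\<^sup>2 dvd int n * ?N"
    using pow[of ?u "int n + 1" n] by simp
  moreover have "algebraic_semidom_class.coprime (?u\<^sup>2) (int n)"
  proof -
    have "algebraic_semidom_class.coprime ?u (int n)"
      by (rule algebraic_semidom_class.coprimeI) (metis dvd_add_left_iff dvd_mult)
    then show ?thesis by simp
  qed
  ultimately show ?thesis
    using coprime_dvd_mult_right_iff by blast
qed

lemma of_int_\<D>: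
  assumes "n \<ge> 1"
  shows "rat_of_int (\<D> n b m) =
    (of_nat n ^ n * (1 - of_int b * of_int m ^ (2 * n)) ^ (n + 1)
       + of_int b * of_int m ^ (2 * n) * (of_nat n + 1) ^ (n + 1))
    / (1 + of_int b * of_int m ^ (2 * n) * of_nat n)\<^sup>2"
  unfolding \<D>_def of_int_div[OF \<D>_denominator_dvd[OF assms, of "b * m ^ (2 * n)"]] by simp

lemma of_int_reduced_\<D>:
  assumes "b * m \<noteq> 0"
  shows "rat_of_int (reduced_\<D> n b m) =
    of_int \<bar>\<D> n b m\<bar> / of_int (\<Prod>p \<in> {p. prime p \<and> p dvd b * m}. p ^ multiplicity p (\<D> n b m))"
proof -
  have "(\<Prod>p\<in>A. p ^ multiplicity p x) dvd x"
    if "finite A" "\<And>p. p \<in> A \<Longrightarrow> prime p" for A and x :: int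
    using that
  proof (induction A)
    case (insert q A)
    then have "algebraic_semidom_class.coprime (q ^ multiplicity q x) (\<Prod>p\<in>A. p ^ multiplicity p x)"
      by (intro prod_coprime_right) (auto intro!: primes_coprime)
    with insert show ?case
      by (simp add: divides_mult multiplicity_dvd)
  qed simp
  moreover have "finite {p :: int. prime p \<and> p dvd b * m}"
    using finite_prime_divisors[OF assms] by simp
  ultimately have "(\<Prod>p \<in> {p. prime p \<and> p dvd b * m}. p ^ multiplicity p (\<D> n b m)) dvd \<D> n b m"
    by blast
  then show ?thesis
    unfolding reduced_\<D>_def by (subst of_int_div) simp_all
qed

end

theory Submission
  imports Defs "Jordan_Normal_Form.Char_Poly"
begin

text \<open>By a criterion of Dedekind and Uchida, for a monic irreducible \<open>f\<close> with root \<open>\<theta>\<close> the ring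
  \<open>\<int>[\<theta>]\<close> is integrally closed unless \<open>f\<close> lies in the square of a maximal ideal \<open>M = (p, g)\<close>
  of \<open>\<int>[x]\<close>. For \<open>\<F>\<close> three kinds of primes occur. If \<open>p\<close> divides \<open>b\<close>, then \<open>x \<in> M\<close>, and the
  constant term \<open>b\<close> is not divisible by \<open>p\<^sup>2\<close>. If \<open>p\<close> divides \<open>m\<close>, then \<open>\<F> \<equiv> x\<^bsup>nk\<^esup> + b\<close> modulo \<open>p\<^sup>2\<close>, and
  with \<open>y = x\<^bsup>nk/p\<^esup>\<close> and \<open>y + b \<in> M\<close> the binomial expansion of \<open>((y + b) - b)\<^sup>p + b\<close> is
  \<open>(- b)\<^sup>p + b\<close> modulo \<open>M\<^sup>2\<close>; this is the Wieferich condition. Otherwise \<open>p\<close> does not divide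
  \<open>bmk\<close>; with \<open>y = x\<^sup>k\<close> the product \<open>(m\<^sup>2y - 1)\<F>\<close> is a trinomial in \<open>y\<close>, and evaluating it at its
  critical point modulo \<open>M\<^sup>2\<close> shows that \<open>p\<^sup>2\<close> would divide \<open>\<D>\<close>.\<close>

section \<open>Algebraic integers\<close>

text \<open>A commutative ring as a module over the integers: \<open>int_mod.span S\<close> is the
  additive subgroup generated by \<open>S\<close>.\<close>

interpretation int_mod: Modules.module "\<lambda>(c::int) (x::'a::comm_ring_1). of_int c * x"
  by unfold_locales (simp_all add: algebra_simps)

lemma int_span_mult_closed:
  assumes "\<And>s. s \<in> S \<Longrightarrow> x * s \<in> int_mod.span T" and "y \<in> int_mod.span S"
  shows "x * y \<in> int_mod.span T"
  using assms(2)
proof (induction rule: int_mod.span_induct_alt)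
  case base
  then show ?case by (simp add: int_mod.span_zero)
next
  case (step c s y)
  have "x * (of_int c * s + y) = of_int c * (x * s) + x * y"
    by (simp add: algebra_simps)
  then show ?case
    using step assms(1)[of s] by (simp add: int_mod.span_add int_mod.span_scale)
qed

text \<open>The determinant trick: \<open>z\<close> acts on the generators through an integer
  matrix, the vector of generators is an eigenvector for \<open>z\<close>, and the characteristic
  polynomial is monic over the integers. The generator \<open>s0\<close> keeps that vector from
  being zero.\<close>

lemma algebraic_int_if_fg_module:
  fixes z :: "'a :: field_char_0"
  assumes fin: "finite S" and nz: "s0 \<in> S" "s0 \<noteq> 0"
    and closed: "\<And>s. s \<in> S \<Longrightarrow> z * s \<in> int_mod.span S"
  shows "algebraic_int z"
proof -
  define n where "n = card S"
  obtain v where v: "bij_betw v {..<n} S"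
    using ex_bij_betw_nat_finite[OF fin] unfolding n_def atLeast0LessThan by blast
  have "\<exists>u. z * s = (\<Sum>t\<in>S. of_int (u t) * t)" if "s \<in> S" for s
    using closed[OF that] unfolding int_mod.span_finite[OF fin] by auto
  then obtain u where u: "\<And>s. s \<in> S \<Longrightarrow> z * s = (\<Sum>t\<in>S. of_int (u s t) * t)"
    by metis
  define A :: "int mat" where "A = mat n n (\<lambda>(i,j). u (v i) (v j))"
  have A: "A \<in> carrier_mat n n" by (simp add: A_def)
  define A' :: "'a mat" where "A' = map_mat of_int A"
  have A': "A' \<in> carrier_mat n n" using A by (simp add: A'_def)
  have "eigenvector A' (vec n v) z"
    unfolding eigenvector_def
  proof (intro conjI)
    show "vec n v \<in> carrier_vec (dim_row A')" using A' by auto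
    obtain i where i: "i < n" "v i = s0"
      using v nz(1) unfolding bij_betw_def by (metis imageE lessThan_iff)
    show "vec n v \<noteq> 0\<^sub>v (dim_row A')"
    proof
      assume "vec n v = 0\<^sub>v (dim_row A')"
      then have "vec_index (vec n v) i = 0" using i A' by auto
      then show False using i nz by simp
    qed
    show "A' *\<^sub>v vec n v = z \<cdot>\<^sub>v vec n v"
    proof (rule eq_vecI)
      fix i assume "i < dim_vec (z \<cdot>\<^sub>v vec n v)"
      then have i: "i < n" by simp
      then have "v i \<in> S" using v by (auto simp: bij_betw_def)
      have "vec_index (A' *\<^sub>v vec n v) i = (\<Sum>j<n. of_int (u (v i) (v j)) * v j)"
        using i by (simp add: A'_def A_def scalar_prod_def atLeast0LessThan)
      also have "\<dots> = (\<Sum>t\<in>S. of_int (u (v i) t) * t)"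
        by (rule sum.reindex_bij_betw[OF v])
      also have "\<dots> = vec_index (z \<cdot>\<^sub>v vec n v) i" using u[OF \<open>v i \<in> S\<close>] i by simp
      finally show "vec_index (A' *\<^sub>v vec n v) i = vec_index (z \<cdot>\<^sub>v vec n v) i" .
    qed (use A' in auto)
  qed
  then have "poly (char_poly A') z = 0"
    using eigenvalue_root_char_poly[OF A'] unfolding eigenvalue_def by blast
  then have "poly (map_poly of_int (char_poly A)) z = 0"
    unfolding A'_def of_int_hom.char_poly_hom[OF A] .
  moreover have "lead_coeff (char_poly A) = 1"
    using degree_monic_char_poly[OF A] by simp
  ultimately show ?thesis unfolding algebraic_int_altdef_ipoly by blast
qed

lemma algebraic_int_power_relation:
  fixes x :: "'a :: field_char_0"
  assumes "algebraic_int x"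
  obtains d c where "d > 0" "x ^ d = (\<Sum>i<d. of_int (c i) * x ^ i)"
proof -
  obtain p where p: "poly (map_poly of_int p) x = 0" "lead_coeff p = 1"
    using assms unfolding algebraic_int_altdef_ipoly by blast
  define d where "d = degree p"
  have "poly (map_poly of_int p) x = (\<Sum>i\<le>d. of_int (coeff p i) * x ^ i)"
    by (simp add: poly_altdef d_def)
  also have "\<dots> = x ^ d + (\<Sum>i<d. of_int (coeff p i) * x ^ i)"
    using p(2) by (simp add: lessThan_Suc_atMost[symmetric] d_def)
  finally have "x ^ d = (\<Sum>i<d. of_int (- coeff p i) * x ^ i)"
    using p(1) by (simp add: sum_negf eq_neg_iff_add_eq_0)
  moreover have "d > 0"
  proof (rule ccontr)
    assume "\<not> d > 0"
    then have "p = 1" using monic_degree_0[OF p(2)] unfolding d_def by simp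
    then show False using p(1) by simp
  qed
  ultimately show thesis by (rule that[rotated])
qed

text \<open>The monomials \<open>x ^ i * y ^ j\<close> below the degrees of two monic relations span
  Z[x, y]; multiplication leaves this range only at the top exponent, where the relation rewrites
  it.\<close>

lemma algebraic_int_pair_module:
  fixes x y :: "'a :: field_char_0"
  assumes "algebraic_int x" "algebraic_int y"
  obtains S where "finite S" "1 \<in> S"
    "\<forall>s\<in>S. x * s \<in> int_mod.span S" "\<forall>s\<in>S. y * s \<in> int_mod.span S"
proof -
  obtain d a where d: "d > 0" "x ^ d = (\<Sum>i<d. of_int (a i) * x ^ i)"
    using algebraic_int_power_relation[OF assms(1)] .
  obtain e b where e: "e > 0" "y ^ e = (\<Sum>i<e. of_int (b i) * y ^ i)"
    using algebraic_int_power_relation[OF assms(2)] .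
  define S where "S = (\<lambda>(i,j). x ^ i * y ^ j) ` ({..<d} \<times> {..<e})"
  have S: "x ^ i * y ^ j \<in> S" if "i < d" "j < e" for i j
    using that by (auto simp: S_def)
  have "finite S" by (simp add: S_def)
  moreover have "1 \<in> S" using S[OF d(1) e(1)] by simp
  moreover have "\<forall>s\<in>S. x * s \<in> int_mod.span S"
  proof
    fix s assume s: "s \<in> S"
    obtain i j where ij: "i < d" "j < e" "s = x ^ i * y ^ j" using s by (auto simp: S_def)
    show "x * s \<in> int_mod.span S"
    proof (cases "Suc i = d")
      case True
      have "x * s = x ^ d * y ^ j" using ij(3) by (simp add: True[symmetric] mult_ac)
      also have "\<dots> = (\<Sum>l<d. of_int (a l) * (x ^ l * y ^ j))"
        unfolding d(2) sum_distrib_right by (simp add: mult_ac)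
      finally have "x * s = (\<Sum>l<d. of_int (a l) * (x ^ l * y ^ j))" .
      then show "x * s \<in> int_mod.span S" using ij S
        by (auto intro!: int_mod.span_sum int_mod.span_scale[OF int_mod.span_base])
    next
      case False
      then show "x * s \<in> int_mod.span S" using ij S[of "Suc i" j]
        by (auto intro!: int_mod.span_base simp: mult.assoc)
    qed
  qed
  moreover have "\<forall>s\<in>S. y * s \<in> int_mod.span S"
  proof
    fix s assume s: "s \<in> S"
    obtain i j where ij: "i < d" "j < e" "s = x ^ i * y ^ j" using s by (auto simp: S_def)
    show "y * s \<in> int_mod.span S"
    proof (cases "Suc j = e")
      case True
      have "y * s = x ^ i * y ^ e" using ij(3) by (simp add: True[symmetric] mult_ac)
      also have "\<dots> = (\<Sum>l<e. of_int (b l) * (x ^ i * y ^ l))"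
        unfolding e(2) sum_distrib_left by (simp add: mult_ac)
      finally have "y * s = (\<Sum>l<e. of_int (b l) * (x ^ i * y ^ l))" .
      then show "y * s \<in> int_mod.span S" using ij S
        by (auto intro!: int_mod.span_sum int_mod.span_scale[OF int_mod.span_base])
    next
      case False
      have "y * s = x ^ i * y ^ Suc j" using ij(3) by (simp add: mult_ac)
      moreover have "x ^ i * y ^ Suc j \<in> S" using ij(1,2) False by (intro S) auto
      ultimately show "y * s \<in> int_mod.span S" by (metis int_mod.span_base)
    qed
  qed
  ultimately show thesis by (rule that)
qed

lemma algebraic_int_add:
  fixes x y :: "'a :: field_char_0"
  assumes "algebraic_int x" "algebraic_int y"
  shows "algebraic_int (x + y)"
proof -
  obtain S where fin: "finite S" "1 \<in> S" and "\<forall>s\<in>S. x * s \<in> int_mod.span S"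
    "\<forall>s\<in>S. y * s \<in> int_mod.span S"
    using algebraic_int_pair_module[OF assms] .
  then have S: "x * s \<in> int_mod.span S" "y * s \<in> int_mod.span S" if "s \<in> S" for s
    using that by auto
  show ?thesis
    by (rule algebraic_int_if_fg_module[OF fin])
       (simp_all add: distrib_right S int_mod.span_add)
qed

lemma algebraic_int_mult:
  fixes x y :: "'a :: field_char_0"
  assumes "algebraic_int x" "algebraic_int y"
  shows "algebraic_int (x * y)"
proof -
  obtain S where fin: "finite S" "1 \<in> S" and "\<forall>s\<in>S. x * s \<in> int_mod.span S"
    "\<forall>s\<in>S. y * s \<in> int_mod.span S"
    using algebraic_int_pair_module[OF assms] .
  then have S: "x * s \<in> int_mod.span S" "y * s \<in> int_mod.span S" if "s \<in> S" for s
    using that by auto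
  show ?thesis
    by (rule algebraic_int_if_fg_module[OF fin])
       (simp_all add: mult.assoc int_span_mult_closed[OF S(1)] S(2))
qed

text \<open>Adjoining \<open>z * S\<close> to a module stable under the coefficients gives one
  stable under \<open>z\<close>, since the equation rewrites \<open>z * z\<close>. In the
  Dedekind-Uchida criterion this shows that the new element is integral.\<close>

lemma algebraic_int_monic_quadratic:
  fixes x y z :: "'a :: field_char_0"
  assumes "algebraic_int x" "algebraic_int y" and z: "z\<^sup>2 + x * z + y = 0"
  shows "algebraic_int z"
proof -
  obtain S where fin: "finite S" "1 \<in> S" and "\<forall>s\<in>S. x * s \<in> int_mod.span S"
    "\<forall>s\<in>S. y * s \<in> int_mod.span S"
    using algebraic_int_pair_module[OF assms(1,2)] .
  then have S: "x * s \<in> int_mod.span S" "y * s \<in> int_mod.span S" if "s \<in> S" for s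
    using that by auto
  define T where "T = S \<union> (*) z ` S"
  have zT: "z * t \<in> int_mod.span T" if "t \<in> int_mod.span S" for t
    by (rule int_span_mult_closed[OF _ that]) (auto simp: T_def intro: int_mod.span_base)
  have ST: "t \<in> int_mod.span T" if "t \<in> int_mod.span S" for t
    by (rule subsetD[OF int_mod.span_mono that]) (simp add: T_def)
  show ?thesis
  proof (rule algebraic_int_if_fg_module[of T 1])
    fix t assume "t \<in> T"
    then consider "t \<in> S" | s where "s \<in> S" "t = z * s" unfolding T_def by auto
    then show "z * t \<in> int_mod.span T"
    proof cases
      case 1
      then show ?thesis by (auto intro: zT int_mod.span_base)
    next
      case 2
      have "z * t = (z\<^sup>2 + x * z + y) * s - z * (x * s) - y * s"
        unfolding 2(2) by (simp add: algebra_simps power2_eq_square)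
      then have "z * t = - (z * (x * s)) - y * s" unfolding z by simp
      then show ?thesis using S[OF 2(1)] zT ST
        by (simp add: int_mod.span_diff int_mod.span_neg)
    qed
  qed (use fin in \<open>auto simp: T_def\<close>)
qed

lemma algebraic_int_of_int_poly:
  fixes x :: "'a :: field_char_0"
  assumes "algebraic_int x"
  shows "algebraic_int (poly (map_poly of_int r) x)"
proof (induction r)
  case (pCons a r)
  then show ?case
    using algebraic_int_add[OF int_imp_algebraic_int algebraic_int_mult[OF assms]]
    by (simp add: map_poly_pCons)
qed simp

section \<open>Ideals with two generators and their squares\<close>

definition ideal2 :: "'a::comm_ring_1 \<Rightarrow> 'a \<Rightarrow> 'a set" where
  "ideal2 a b = {a * x + b * y | x y. True}"

text \<open>The square of the ideal \<open>ideal2 a b\<close>, through its three generators.\<close>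

definition ideal2_sq :: "'a::comm_ring_1 \<Rightarrow> 'a \<Rightarrow> 'a set" where
  "ideal2_sq a b = {a\<^sup>2 * x + a * b * y + b\<^sup>2 * z | x y z. True}"

lemma ideal2_memI: "h = a * x + b * y \<Longrightarrow> h \<in> ideal2 a b"
  unfolding ideal2_def by blast

lemma ideal2_gens [simp]: "a \<in> ideal2 a b" "b \<in> ideal2 a b" "0 \<in> ideal2 a b"
  by (auto intro: ideal2_memI[of _ _ 1 _ 0] ideal2_memI[of _ _ 0 _ 1] ideal2_memI[of _ _ 0 _ 0])

lemma ideal2_add: "u \<in> ideal2 a b \<Longrightarrow> v \<in> ideal2 a b \<Longrightarrow> u + v \<in> ideal2 a b"
proof -
  assume "u \<in> ideal2 a b" "v \<in> ideal2 a b"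
  then obtain x y x' y' where "u = a * x + b * y" "v = a * x' + b * y'"
    unfolding ideal2_def by blast
  then have "u + v = a * (x + x') + b * (y + y')" by (simp add: algebra_simps)
  then show ?thesis by (rule ideal2_memI)
qed

lemma ideal2_mult: "u \<in> ideal2 a b \<Longrightarrow> v * u \<in> ideal2 a b"
proof -
  assume "u \<in> ideal2 a b"
  then obtain x y where "u = a * x + b * y" unfolding ideal2_def by blast
  then have "v * u = a * (v * x) + b * (v * y)" by (simp add: algebra_simps)
  then show ?thesis by (rule ideal2_memI)
qed

lemma ideal2_mult': "u \<in> ideal2 a b \<Longrightarrow> u * v \<in> ideal2 a b"
  using ideal2_mult[of u a b v] by (simp add: mult.commute)

lemma ideal2_minus: "u \<in> ideal2 a b \<Longrightarrow> - u \<in> ideal2 a b"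
  using ideal2_mult[of u a b "-1"] by simp

lemma ideal2_diff: "u \<in> ideal2 a b \<Longrightarrow> v \<in> ideal2 a b \<Longrightarrow> u - v \<in> ideal2 a b"
  using ideal2_add[OF _ ideal2_minus[of v]] by simp

lemma ideal2_sq_memI: "h = a\<^sup>2 * x + a * b * y + b\<^sup>2 * z \<Longrightarrow> h \<in> ideal2_sq a b"
  unfolding ideal2_sq_def by blast

lemma ideal2_mult_sq:
  assumes "u \<in> ideal2 a b" "v \<in> ideal2 a b" shows "u * v \<in> ideal2_sq a b"
proof -
  obtain x y x' y' where "u = a * x + b * y" "v = a * x' + b * y'"
    using assms unfolding ideal2_def by blast
  then have "u * v = a\<^sup>2 * (x * x') + a * b * (x * y' + x' * y) + b\<^sup>2 * (y * y')"
    by (simp add: algebra_simps power2_eq_square)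
  then show ?thesis by (rule ideal2_sq_memI)
qed

lemma ideal2_sq_add:
  assumes "u \<in> ideal2_sq a b" "v \<in> ideal2_sq a b" shows "u + v \<in> ideal2_sq a b"
proof -
  obtain x y z x' y' z' where "u = a\<^sup>2 * x + a * b * y + b\<^sup>2 * z"
    "v = a\<^sup>2 * x' + a * b * y' + b\<^sup>2 * z'"
    using assms unfolding ideal2_sq_def by blast
  then have "u + v = a\<^sup>2 * (x + x') + a * b * (y + y') + b\<^sup>2 * (z + z')"
    by (simp add: algebra_simps)
  then show ?thesis by (rule ideal2_sq_memI)
qed

lemma ideal2_sq_mult:
  assumes "u \<in> ideal2_sq a b" shows "v * u \<in> ideal2_sq a b"
proof -
  obtain x y z where "u = a\<^sup>2 * x + a * b * y + b\<^sup>2 * z"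
    using assms unfolding ideal2_sq_def by blast
  then have "v * u = a\<^sup>2 * (v * x) + a * b * (v * y) + b\<^sup>2 * (v * z)"
    by (simp add: algebra_simps)
  then show ?thesis by (rule ideal2_sq_memI)
qed

lemma ideal2_sq_minus: "u \<in> ideal2_sq a b \<Longrightarrow> - u \<in> ideal2_sq a b"
  using ideal2_sq_mult[of u a b "-1"] by simp

lemma ideal2_sq_diff: "u \<in> ideal2_sq a b \<Longrightarrow> v \<in> ideal2_sq a b \<Longrightarrow> u - v \<in> ideal2_sq a b"
  using ideal2_sq_add[OF _ ideal2_sq_minus[of v]] by simp

lemma ideal2_sq_subset:
  assumes "u \<in> ideal2_sq a b" shows "u \<in> ideal2 a b"
proof -
  obtain x y z where "u = a\<^sup>2 * x + a * b * y + b\<^sup>2 * z"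
    using assms unfolding ideal2_sq_def by blast
  then have "u = a * (a * x + b * y) + b * (b * z)"
    by (simp add: algebra_simps power2_eq_square)
  then show ?thesis by (rule ideal2_memI)
qed

section \<open>Division by monic polynomials and constants in the ideal (p, g)\<close>

lemma monic_division:
  fixes f g :: "int poly"
  assumes "lead_coeff g = 1"
  obtains q r where "f = g * q + r" "r = 0 \<or> degree r < degree g"
proof -
  obtain q r where qr: "pseudo_divmod f g = (q, r)" by (cases "pseudo_divmod f g")
  have "g \<noteq> 0" using assms by auto
  from pseudo_divmod[OF this qr] that assms show thesis by simp
qed

text \<open>\<open>[:p:]\<close> is a prime element of Z[x], and it cannot divide a monic
  factor.\<close>

lemma const_poly_dvd_cancel_monic:
  fixes g v :: "int poly"
  assumes "prime p" "lead_coeff g = 1" "[:p:] dvd g * v"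
  shows "[:p:] dvd v"
proof -
  have "prime_elem [:p:]" using assms(1) by (subst prime_elem_const_poly_iff) (rule prime_imp_prime_elem)
  then have "[:p:] dvd g \<or> [:p:] dvd v" using assms(3) by (rule prime_elem_dvd_multD)
  moreover have "\<not> [:p:] dvd g"
  proof
    assume "[:p:] dvd g"
    then have "p dvd lead_coeff g" unfolding const_poly_dvd_iff by blast
    then show False using assms(1,2) by (metis not_prime_unit)
  qed
  ultimately show ?thesis by blast
qed

text \<open>Once the cofactor of \<open>[:a:]\<close> is reduced modulo \<open>g\<close>, comparing
  degrees kills the multiple of \<open>g\<close>. This turns ideal membership into divisibility of
  integers.\<close>

lemma const_mem_ideal_monic:
  fixes g :: "int poly"
  assumes g: "lead_coeff g = 1" "degree g > 0" and c: "[:c:] \<in> ideal2 [:a:] g"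
  shows "a dvd c"
proof -
  obtain x y where xy: "[:c:] = [:a:] * x + g * y" using c unfolding ideal2_def by blast
  obtain q r where qr: "x = g * q + r" "r = 0 \<or> degree r < degree g"
    using monic_division[OF g(1)] .
  have eq: "[:c:] - [:a:] * r = g * ([:a:] * q + y)" using xy qr(1) by (simp add: algebra_simps)
  have "degree ([:c:] - [:a:] * r) < degree g"
    using qr(2) g(2) by (auto intro!: degree_diff_less)
  then have "[:a:] * q + y = 0"
    using degree_mult_eq[of g "[:a:] * q + y"] g unfolding eq by (metis degree_0 leD le_add1 not_gr0)
  then have "[:c:] = [:a:] * r" using eq by simp
  then have "coeff [:c:] 0 = coeff ([:a:] * r) 0" by (rule arg_cong)
  then have "c = a * coeff r 0" by simp
  then show ?thesis by simp
qed

text \<open>The square is contained in the ideal generated by \<open>a^2\<close> and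
  \<open>g\<close>.\<close>

lemma const_mem_ideal_sq_monic:
  fixes g :: "int poly"
  assumes g: "lead_coeff g = 1" "degree g > 0" and c: "[:c:] \<in> ideal2_sq [:a:] g"
  shows "a\<^sup>2 dvd c"
proof -
  obtain x y z where "[:c:] = [:a:]\<^sup>2 * x + [:a:] * g * y + g\<^sup>2 * z"
    using c unfolding ideal2_sq_def by blast
  then have "[:c:] = [:a\<^sup>2:] * x + g * ([:a:] * y + g * z)"
    by (simp add: algebra_simps power2_eq_square)
  then show ?thesis by (intro const_mem_ideal_monic[OF g] ideal2_memI)
qed

text \<open>By the Leibniz rule each term keeps one factor in the ideal: the ideal form of the fact
  that a double root is a root of the derivative.\<close>

lemma pderiv_ideal_sq:
  fixes f g :: "int poly"
  assumes "f \<in> ideal2_sq [:a:] g"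
  shows "pderiv f \<in> ideal2 [:a:] g"
proof -
  obtain x y z where "f = [:a:]\<^sup>2 * x + [:a:] * g * y + g\<^sup>2 * z"
    using assms unfolding ideal2_sq_def by blast
  then have "pderiv f = [:a:] * ([:a:] * pderiv x + g * pderiv y + y * pderiv g)
      + g * (g * pderiv z + 2 * z * pderiv g)"
    by (simp add: pderiv_add pderiv_mult pderiv_smult power2_eq_square algebra_simps smult_add_right)
  then show ?thesis by (rule ideal2_memI)
qed

text \<open>Over the field with \<open>p\<close> elements a nonzero polynomial can be scaled to be
  monic. Leading terms divisible by \<open>p\<close> are dropped by induction on the degree.\<close>

lemma monic_representative_mod_prime:
  fixes r :: "int poly"
  assumes p: "prime p" and "\<not> [:p:] dvd r"
  obtains c s t where "lead_coeff s = 1" "degree s \<le> degree r" "s = [:c:] * r + [:p:] * t"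
proof -
  have "\<exists>c s t. lead_coeff s = 1 \<and> degree s \<le> degree r \<and> s = [:c:] * r + [:p:] * t"
    using assms(2)
  proof (induction "degree r" arbitrary: r rule: less_induct)
    case less
    define d where "d = degree r"
    define l where "l = lead_coeff r"
    show ?case
    proof (cases "p dvd l")
      case True
      then obtain l' where l': "l = p * l'" by auto
      define r' where "r' = r - monom l d"
      have r: "r = r' + [:p:] * monom l' d"
        by (simp add: r'_def l' smult_monom)
      have "\<not> [:p:] dvd r'"
      proof
        assume "[:p:] dvd r'"
        then have "[:p:] dvd r" unfolding r by (rule dvd_add) (rule dvd_triv_left)
        then show False using less.prems by simp
      qed
      then have "r' \<noteq> 0" by auto
      have "degree r' < degree r"
      proof -
        have "degree r' \<le> d" unfolding r'_def
          by (intro degree_diff_le) (simp_all add: d_def degree_monom_le)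
        moreover have "coeff r' d = 0" by (simp add: r'_def l_def d_def)
        ultimately show ?thesis using \<open>r' \<noteq> 0\<close> unfolding d_def
          by (metis le_neq_implies_less leading_coeff_0_iff)
      qed
      from less.hyps[OF this \<open>\<not> [:p:] dvd r'\<close>] obtain c s t where
        s: "lead_coeff s = 1" "degree s \<le> degree r'" "s = [:c:] * r' + [:p:] * t" by blast
      have "s = [:c:] * r + [:p:] * (t - [:c:] * monom l' d)"
        unfolding s(3) r by (simp add: algebra_simps)
      with s \<open>degree r' < degree r\<close> show ?thesis by (metis le_less_trans less_imp_le)
    next
      case False
      then have "gcd l p = 1"
        using p by (metis prime_imp_coprime coprime_imp_gcd_eq_1 gcd.commute)
      then obtain c e where ce: "c * l + e * p = 1" using bezout_int[of l p] by metis
      \<comment> \<open>\<open>c\<close> inverts \<open>l\<close> modulo \<open>p\<close>; the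
        correction by \<open>e\<close> makes the leading coefficient equal to 1, not merely
        congruent to it.\<close>
      define s where "s = [:c:] * r + [:p:] * monom e d"
      have "degree s \<le> d" unfolding s_def
        by (intro degree_add_le) (auto simp: d_def intro: order_trans[OF degree_smult_le] degree_monom_le)
      moreover have "coeff s d = 1" using ce by (simp add: s_def l_def d_def mult.commute)
      ultimately have "degree s = d" by (metis le_antisym le_degree zero_neq_one)
      then have "lead_coeff s = 1 \<and> degree s \<le> degree r" using \<open>coeff s d = 1\<close> d_def by simp
      then show ?thesis using s_def by blast
    qed
  qed
  then show thesis using that by blast
qed

text \<open>A maximal ideal \<open>(p, g)\<close> is found as the annihilator of a suitable multiple \<open>k\<close> of \<open>h\<close>
  in \<open>\<int>[x] / (p, f)\<close>; minimality of \<open>degree g\<close> makes the annihilator prime.\<close>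

lemma prime_annihilator_exists:
  fixes f h :: "int poly"
  assumes p: "prime p" and f: "lead_coeff f = 1" and h: "h \<notin> ideal2 [:p:] f"
  obtains g w where "lead_coeff g = 1" "degree g > 0" "w * h \<notin> ideal2 [:p:] f"
    "\<forall>r. r * (w * h) \<in> ideal2 [:p:] f \<longleftrightarrow> r \<in> ideal2 [:p:] g"
    "\<forall>r s. r * s \<in> ideal2 [:p:] g \<longrightarrow> r \<in> ideal2 [:p:] g \<or> s \<in> ideal2 [:p:] g"
proof -
  let ?I = "ideal2 [:p:] f"
  define Q where "Q = (\<lambda>(g, w). lead_coeff g = 1 \<and> degree g > 0 \<and> w * h \<notin> ?I \<and> g * (w * h) \<in> ?I)"
  have "degree f > 0"
  proof (rule ccontr)
    assume "\<not> degree f > 0"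
    then have "f = 1" using monic_degree_0[OF f] by simp
    then show False using h by (metis ideal2_gens(2) ideal2_mult mult.right_neutral)
  qed
  \<comment> \<open>Admissible pairs exist, because \<open>f\<close> kills everything modulo (p,
    f).\<close>
  then have "Q (f, 1)" unfolding Q_def using f h by (auto intro: ideal2_mult')
  from ex_has_least_nat[of Q, OF this, of "\<lambda>(g, w). degree g"]
  obtain g w where gw: "Q (g, w)" and min: "\<And>g' w'. Q (g', w') \<Longrightarrow> degree g \<le> degree g'" by auto
  have g: "lead_coeff g = 1" "degree g > 0" using gw by (auto simp: Q_def)
  \<comment> \<open>The remainder of \<open>r\<close> modulo \<open>g\<close> also kills
    \<open>w' * h\<close>. If it is nonzero modulo \<open>p\<close>, its monic representative is
    either admissible of smaller degree than \<open>g\<close>, or the constant 1, which does not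
    kill \<open>w' * h\<close>.\<close>
  have mem: "r \<in> ideal2 [:p:] g"
    if w': "w' * h \<notin> ?I" "g * (w' * h) \<in> ?I" and r: "r * (w' * h) \<in> ?I" for r w'
  proof (rule ccontr)
    assume nr: "r \<notin> ideal2 [:p:] g"
    obtain q r' where qr: "r = g * q + r'" "r' = 0 \<or> degree r' < degree g"
      using monic_division[OF g(1)] .
    have "\<not> [:p:] dvd r'"
    proof
      assume "[:p:] dvd r'"
      then have "r' \<in> ideal2 [:p:] g" by (auto elim!: dvdE simp: ideal2_mult' simp del: mult_pCons_left)
      then show False using nr qr(1) by (simp add: ideal2_add ideal2_mult')
    qed
    then obtain c s t where s: "lead_coeff s = 1" "degree s \<le> degree r'" "s = [:c:] * r' + [:p:] * t"
      by (rule monic_representative_mod_prime[OF p])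
    have "r' \<noteq> 0" using \<open>\<not> [:p:] dvd r'\<close> by auto
    then have deg: "degree s < degree g" using s(2) qr(2) by auto
    have "r' * (w' * h) = r * (w' * h) - q * (g * (w' * h))"
      unfolding qr(1) by (simp add: algebra_simps)
    then have "r' * (w' * h) \<in> ?I" using ideal2_diff[OF r ideal2_mult[OF w'(2)]] by metis
    moreover have "s * (w' * h) = [:c:] * (r' * (w' * h)) + [:p:] * (t * (w' * h))"
      unfolding s(3) by (simp add: algebra_simps)
    ultimately have sI: "s * (w' * h) \<in> ?I"
      by (metis ideal2_add ideal2_mult ideal2_mult' ideal2_gens(1))
    have "degree s > 0"
    proof (rule ccontr)
      assume "\<not> degree s > 0"
      then have "s = 1" using monic_degree_0[OF s(1)] by simp
      then show False using sI w'(1) by simp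
    qed
    then have "Q (s, w')" using s(1) w'(1) sI by (simp add: Q_def)
    then show False using min deg by fastforce
  qed
  have wI: "w * h \<notin> ?I" "g * (w * h) \<in> ?I" using gw by (auto simp: Q_def)
  have ann: "v * (w' * h) \<in> ?I"
    if w': "g * (w' * h) \<in> ?I" and v: "v \<in> ideal2 [:p:] g" for v w'
  proof -
    obtain x y where xy: "v = [:p:] * x + g * y" using v unfolding ideal2_def by blast
    have "v * (w' * h) = [:p:] * (x * (w' * h)) + y * (g * (w' * h))"
      unfolding xy by (simp add: algebra_simps)
    then show ?thesis by (metis ideal2_add ideal2_mult ideal2_mult' ideal2_gens(1) w')
  qed
  have iff: "\<forall>r. r * (w * h) \<in> ?I \<longleftrightarrow> r \<in> ideal2 [:p:] g"
    using mem[OF wI] ann[OF wI(2)] by blast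
  \<comment> \<open>If \<open>s\<close> is outside the annihilator, then \<open>s * w * h\<close> is
    still nonzero and killed by \<open>g\<close>, so \<open>mem\<close> applies to it and to
    \<open>r\<close>.\<close>
  have "r \<in> ideal2 [:p:] g \<or> s \<in> ideal2 [:p:] g" if rs: "r * s \<in> ideal2 [:p:] g" for r s
  proof (cases "s \<in> ideal2 [:p:] g")
    case False
    then have 1: "(s * w) * h \<notin> ?I" using iff by (simp add: mult.assoc)
    have 2: "g * ((s * w) * h) \<in> ?I" using ideal2_mult[OF wI(2), of s] by (simp add: mult_ac)
    have 3: "r * ((s * w) * h) \<in> ?I" using ann[OF wI(2) rs] by (simp add: mult_ac)
    show ?thesis using mem[OF 1 2 3] by simp
  qed simp
  then show thesis using that[OF g wI(1) iff] by blast
qed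

section \<open>Integral elements of a simple extension of the rationals\<close>

abbreviation ipoly :: "int poly \<Rightarrow> 'a::comm_ring_1 \<Rightarrow> 'a" where
  "ipoly r x \<equiv> poly (map_poly of_int r) x"

lemma ipoly_simps:
  fixes x :: "'a :: comm_ring_1"
  shows "ipoly (r + s) x = ipoly r x + ipoly s x" "ipoly (r - s) x = ipoly r x - ipoly s x"
    "ipoly (r * s) x = ipoly r x * ipoly s x" "ipoly (r ^ j) x = ipoly r x ^ j"
    "ipoly [:c:] x = of_int c" "ipoly (monom c j) x = of_int c * x ^ j"
    "ipoly (sum F A) x = (\<Sum>i\<in>A. ipoly (F i) x)" "ipoly (Polynomial.smult c r) x = of_int c * ipoly r x"
  by (simp_all add: hom_distribs poly_monom poly_sum)

lemma ipoly_altdef: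
  fixes x :: "'a :: comm_ring_1"
  assumes "degree r < N"
  shows "ipoly r x = (\<Sum>i<N. of_int (coeff r i) * x ^ i)"
proof -
  have "ipoly r x = ipoly (\<Sum>i<N. monom (coeff r i) i) x"
    using assms by (subst poly_as_sum_of_monoms'[of r "N - 1", symmetric])
      (auto simp: lessThan_Suc_atMost[symmetric])
  then show ?thesis by (simp add: ipoly_simps poly_monom)
qed

lemma clear_denominators:
  fixes q :: "rat poly"
  obtains D :: int and r where "D > 0" "Polynomial.smult (of_int D) q = map_poly of_int r"
proof -
  have "\<exists>(D::int) r. D > 0 \<and> Polynomial.smult (of_int D) q = map_poly of_int r"
  proof (induction q)
    case 0
    show ?case by (intro exI[of _ 1] exI[of _ 0]) simp
  next
    case (pCons a q)
    then obtain D :: int and r where D: "D > 0" "Polynomial.smult (of_int D) q = map_poly of_int r" by blast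
    obtain n d where a: "a = of_int n / of_int d" "d > 0"
      by (cases a) (auto simp: Fract_of_int_quotient)
    have "Polynomial.smult (of_int d) (Polynomial.smult (of_int D) q) = map_poly rat_of_int (Polynomial.smult d r)"
      unfolding D(2) by (simp add: hom_distribs)
    then have "Polynomial.smult (of_int (d * D)) (pCons a q) = map_poly of_int (pCons (n * D) (Polynomial.smult d r))"
      using a by (simp add: hom_distribs)
    then show ?case using D(1) a(2) by (metis mult_pos_pos)
  qed
  then show thesis using that by blast
qed

lemma of_rat_poly_simps:
  fixes x :: "'a :: field_char_0"
  shows "poly (map_poly of_rat (q + r)) x = poly (map_poly of_rat q) x + poly (map_poly of_rat r) x"
    "poly (map_poly of_rat (q - r)) x = poly (map_poly of_rat q) x - poly (map_poly of_rat r) x"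
    "poly (map_poly of_rat (q * r)) x = poly (map_poly of_rat q) x * poly (map_poly of_rat r) x"
    "poly (map_poly of_rat (Polynomial.smult c q)) x = of_rat c * poly (map_poly of_rat q) x"
proof -
  interpret h: map_poly_comm_ring_hom "of_rat :: rat \<Rightarrow> 'a" ..
  show "poly (map_poly of_rat (q + r)) x = poly (map_poly of_rat q) x + poly (map_poly of_rat r) x"
    "poly (map_poly of_rat (q - r)) x = poly (map_poly of_rat q) x - poly (map_poly of_rat r) x"
    "poly (map_poly of_rat (q * r)) x = poly (map_poly of_rat q) x * poly (map_poly of_rat r) x"
    "poly (map_poly of_rat (Polynomial.smult c q)) x = of_rat c * poly (map_poly of_rat q) x"
    by (simp_all add: h.hom_add h.hom_minus h.hom_mult of_rat_hom.map_poly_hom_smult)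
qed

locale integral_generator =
  fixes f :: "int poly" and \<theta> :: complex
  assumes monic: "lead_coeff f = 1"
    and irreducible: "irreducible (map_poly rat_of_int f)"
    and root: "ipoly f \<theta> = 0"
begin

lemma degree_pos: "degree f > 0"
proof (rule ccontr)
  assume "\<not> degree f > 0"
  then have "f = 1" using monic_degree_0[OF monic] by simp
  then show False using root by simp
qed

lemma algebraic_int_generator: "algebraic_int \<theta>"
  unfolding algebraic_int_altdef_ipoly using root monic by blast

lemma of_rat_of_int_poly: "map_poly of_rat (map_poly rat_of_int r) = map_poly (of_int :: int \<Rightarrow> complex) r"
  by (subst map_poly_map_poly) (auto simp: o_def)

text \<open>Irreducibility makes the two polynomials coprime; the Bezout identity at
  \<open>\<theta>\<close> yields an inverse.\<close>

lemma rat_poly_bezout: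
  assumes "\<not> map_poly rat_of_int f dvd q"
  obtains v where "poly (map_poly of_rat v) \<theta> * poly (map_poly of_rat q) \<theta> = 1"
proof -
  let ?f = "map_poly rat_of_int f"
  have "algebraic_semidom_class.coprime ?f q"
  proof (rule algebraic_semidom_class.coprimeI)
    fix c assume "c dvd ?f" "c dvd q"
    then show "is_unit c" using irreducible assms
      by (metis dvd_trans dvd_mult_unit_iff' irreducible_altdef)
  qed
  then have "gcd ?f q = 1" by simp
  then have "fst (bezout_coefficients ?f q) * ?f + snd (bezout_coefficients ?f q) * q = 1"
    using bezout_coefficients_fst_snd[of ?f q] by simp
  then obtain u v where uv: "u * ?f + v * q = 1" by blast
  have "poly (map_poly of_rat (u * ?f + v * q)) \<theta> = 1" unfolding uv by simp
  then have "poly (map_poly of_rat v) \<theta> * poly (map_poly of_rat q) \<theta> = 1"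
    using root by (simp add: of_rat_poly_simps of_rat_of_int_poly)
  then show thesis by (rule that)
qed

text \<open>Division by the monic \<open>f\<close> stays over the integers; a nonzero remainder
  vanishing at \<open>\<theta>\<close> would be divisible by \<open>f\<close> over the rationals,
  against its degree.\<close>

lemma ipoly_eq_0_imp_dvd:
  assumes "ipoly r \<theta> = 0" shows "f dvd r"
proof -
  obtain q s where qs: "r = f * q + s" "s = 0 \<or> degree s < degree f"
    using monic_division[OF monic] .
  have s0: "ipoly s \<theta> = 0" using assms root unfolding qs(1) by (simp add: ipoly_simps poly_monom)
  have "map_poly rat_of_int f dvd map_poly rat_of_int s"
  proof (rule ccontr)
    assume "\<not> ?thesis"
    then obtain v where "poly (map_poly of_rat v) \<theta> * poly (map_poly of_rat (map_poly rat_of_int s)) \<theta> = 1"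
      by (rule rat_poly_bezout)
    then show False using s0 by (simp add: of_rat_of_int_poly)
  qed
  then have "s = 0" using qs(2) by (auto dest: dvd_imp_degree_le)
  then show ?thesis using qs(1) by simp
qed

text \<open>The rational polynomial expressions in \<open>\<theta>\<close> already form a field,
  hence contain the least one; then denominators are cleared.\<close>

lemma rat_adjoin_subset:
  assumes "z \<in> rat_adjoin \<theta>"
  obtains r D where "D > 0" "z = ipoly r \<theta> / of_int D"
proof -
  define K where "K = {poly (map_poly of_rat q) \<theta> | q :: rat poly. True}"
  have mem: "poly (map_poly of_rat q) \<theta> \<in> K" for q by (auto simp: K_def)
  have "\<theta> \<in> K" "0 \<in> K" "1 \<in> K" using mem[of "[:0,1:]"] mem[of 0] mem[of 1] by simp_all
  moreover have "x + y \<in> K \<and> x - y \<in> K \<and> x * y \<in> K \<and> x / y \<in> K" if "x \<in> K" "y \<in> K" for x y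
  proof -
    obtain q1 q2 where x: "x = poly (map_poly of_rat q1) \<theta>" and y: "y = poly (map_poly of_rat q2) \<theta>"
      using \<open>x \<in> K\<close> \<open>y \<in> K\<close> unfolding K_def by blast
    have add: "x + y \<in> K" and diff: "x - y \<in> K" and mult: "x * y \<in> K"
      using mem[of "q1 + q2"] mem[of "q1 - q2"] mem[of "q1 * q2"] unfolding x y
      by (simp_all add: of_rat_poly_simps)
    have "x / y \<in> K"
    proof (cases "map_poly rat_of_int f dvd q2")
      case True
      then obtain u where "q2 = map_poly rat_of_int f * u" by auto
      then have "y = 0" unfolding y using root
        by (simp add: of_rat_poly_simps of_rat_of_int_poly)
      then show ?thesis using \<open>0 \<in> K\<close> by simp
    next
      case False
      then obtain v where v: "poly (map_poly of_rat v) \<theta> * y = 1"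
        unfolding y by (rule rat_poly_bezout)
      then have "y \<noteq> 0" by auto
      have "x / y = x * poly (map_poly of_rat v) \<theta> * y / y" using v by (simp add: mult.assoc)
      also have "\<dots> = poly (map_poly of_rat (q1 * v)) \<theta>"
        using \<open>y \<noteq> 0\<close> by (simp add: x of_rat_poly_simps)
      finally show ?thesis using mem by metis
    qed
    then show ?thesis using add diff mult by blast
  qed
  ultimately have "rat_adjoin \<theta> \<subseteq> K" unfolding rat_adjoin_def by blast
  then obtain q where q: "z = poly (map_poly of_rat q) \<theta>" using assms unfolding K_def by blast
  obtain D :: int and r where "D > 0" and qr: "Polynomial.smult (of_int D) q = map_poly rat_of_int r"
    by (rule clear_denominators)
  have "of_int D * z = poly (map_poly of_rat (Polynomial.smult (of_int D) q)) \<theta>"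
    unfolding q by (simp add: of_rat_poly_simps)
  then have "z = ipoly r \<theta> / of_int D"
    using \<open>D > 0\<close> unfolding qr of_rat_of_int_poly by (simp add: field_simps)
  then show thesis using that \<open>D > 0\<close> by blast
qed

lemma ipoly_div_in_rat_adjoin: "ipoly r \<theta> / of_int D \<in> rat_adjoin \<theta>"
  unfolding rat_adjoin_def
proof (rule InterI, clarify)
  fix K assume K: "\<theta> \<in> K" "0 \<in> K" "1 \<in> K"
    "\<forall>x\<in>K. \<forall>y\<in>K. x + y \<in> K \<and> x - y \<in> K \<and> x * y \<in> K \<and> x / y \<in> K"
  have nat: "of_nat j \<in> K" for j by (induction j) (use K in auto)
  have int: "of_int j \<in> K" for j
    by (cases j rule: int_cases2) (use nat K in \<open>auto simp del: of_int_minus\<close>, metis K(2,4) diff_0 nat of_int_minus of_int_of_nat_eq)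
  have "ipoly r \<theta> \<in> K" by (induction r) (use int K in \<open>auto simp: map_poly_pCons\<close>)
  then show "ipoly r \<theta> / of_int D \<in> K" using int K by blast
qed

lemma ipoly_in_ring_of_integers: "ipoly r \<theta> \<in> ring_of_integers (rat_adjoin \<theta>)"
  using ipoly_div_in_rat_adjoin[of r 1] algebraic_int_of_int_poly[OF algebraic_int_generator]
  by (simp add: ring_of_integers_def)

lemma int_span_powers:
  "{\<Sum>i<degree f. of_int (c i) * \<theta> ^ i | c :: nat \<Rightarrow> int. True} = {ipoly r \<theta> | r. True}"
proof (intro equalityI subsetI)
  fix z assume "z \<in> {\<Sum>i<degree f. of_int (c i) * \<theta> ^ i | c :: nat \<Rightarrow> int. True}"
  then obtain c :: "nat \<Rightarrow> int" where "z = (\<Sum>i<degree f. of_int (c i) * \<theta> ^ i)" by blast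
  then have "z = ipoly (\<Sum>i<degree f. monom (c i) i) \<theta>" by (simp add: ipoly_simps poly_monom)
  then show "z \<in> {ipoly r \<theta> | r. True}" by blast
next
  fix z assume "z \<in> {ipoly r \<theta> | r. True}"
  then obtain r where z: "z = ipoly r \<theta>" by blast
  obtain q s where qs: "r = f * q + s" "s = 0 \<or> degree s < degree f"
    using monic_division[OF monic] .
  have "z = ipoly s \<theta>" unfolding z qs(1) using root by (simp add: ipoly_simps poly_monom)
  also have "\<dots> = (\<Sum>i<degree f. of_int (coeff s i) * \<theta> ^ i)"
    using qs(2) degree_pos by (intro ipoly_altdef) auto
  finally show "z \<in> {\<Sum>i<degree f. of_int (c i) * \<theta> ^ i | c :: nat \<Rightarrow> int. True}" by blast
qed

text \<open>Linear independence is automatic, as a relation among the powers would be a multiple of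
  \<open>f\<close> of smaller degree. Only generation remains.\<close>

lemma int_basis_powers_iff:
  "int_basis (degree f) (\<lambda>i. \<theta> ^ i) (ring_of_integers (rat_adjoin \<theta>)) \<longleftrightarrow>
   ring_of_integers (rat_adjoin \<theta>) \<subseteq> {ipoly r \<theta> | r. True}"
proof -
  have "\<forall>i<degree f. c i = 0" if c: "(\<Sum>i<degree f. of_int (c i) * \<theta> ^ i) = 0" for c :: "nat \<Rightarrow> int"
  proof -
    define r where "r = (\<Sum>i<degree f. monom (c i) i)"
    have "ipoly r \<theta> = 0" using c by (simp add: r_def ipoly_simps poly_monom)
    then have "f dvd r" by (rule ipoly_eq_0_imp_dvd)
    moreover have "degree r < degree f"
      unfolding r_def using degree_pos
      by (intro degree_sum_less) (auto intro: le_less_trans[OF degree_monom_le])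
    ultimately have "r = 0" by (auto dest: dvd_imp_degree_le)
    moreover have "coeff r i = c i" if "i < degree f" for i
      using that by (simp add: r_def coeff_sum sum.delta)
    ultimately show ?thesis by auto
  qed
  then show ?thesis
    unfolding int_basis_def int_span_powers using ipoly_in_ring_of_integers by blast
qed

end

section \<open>The Dedekind--Uchida criterion\<close>

context integral_generator
begin

text \<open>With \<open>f = p^2 x + p g y + g^2 z\<close>, the value \<open>\<alpha>\<close> of
  \<open>g z / p\<close> at \<open>\<theta>\<close> satisfies
  \<open>\<alpha>^2 + y \<alpha> + x z = 0\<close>, so it is integral. It is not in Z[\<theta>]:
  otherwise, modulo \<open>p\<close>, either \<open>z\<close> is zero, against \<open>f\<close>
  being monic, or \<open>g\<close> is invertible, against its positive degree.\<close>

lemma not_int_basis_if_ideal_sq: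
  assumes p: "prime p" and g: "lead_coeff g = 1" "degree g > 0" and f: "f \<in> ideal2_sq [:p:] g"
  shows "\<not> int_basis (degree f) (\<lambda>i. \<theta> ^ i) (ring_of_integers (rat_adjoin \<theta>))"
proof
  assume "int_basis (degree f) (\<lambda>i. \<theta> ^ i) (ring_of_integers (rat_adjoin \<theta>))"
  then have sub: "ring_of_integers (rat_adjoin \<theta>) \<subseteq> {ipoly r \<theta> | r. True}"
    by (simp only: int_basis_powers_iff)
  have ring_eq: "g' * (z' * (1 - g' * q')) =
      (g' * z' - P * r' - (P\<^sup>2 * x' + P * g' * y' + g'\<^sup>2 * z') * q') + P * (r' + (P * x' + g' * y') * q')"
    "P\<^sup>2 * x' + P * g' * y' + g'\<^sup>2 * z' = P * (P * x' + g' * y') + g'\<^sup>2 * z'"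
    for P g' q' r' x' y' z' :: "int poly" by (simp_all add: power2_eq_square algebra_simps)
  obtain x y z where f_eq: "f = [:p:]\<^sup>2 * x + [:p:] * g * y + g\<^sup>2 * z"
    using f unfolding ideal2_sq_def by blast
  have "p \<noteq> 0" using p by auto
  define \<alpha> where "\<alpha> = ipoly (g * z) \<theta> / of_int p"
  have p\<alpha>: "of_int p * \<alpha> = ipoly g \<theta> * ipoly z \<theta>"
    using \<open>p \<noteq> 0\<close> by (simp add: \<alpha>_def ipoly_simps)
  have f\<theta>: "ipoly f \<theta> = (of_int p)\<^sup>2 * ipoly x \<theta> + of_int p * ipoly g \<theta> * ipoly y \<theta> + (ipoly g \<theta>)\<^sup>2 * ipoly z \<theta>"
    unfolding f_eq by (simp only: ipoly_simps)
  have eq: "P\<^sup>2 * (a\<^sup>2 + y' * a + x' * z') = (P * a)\<^sup>2 + P * y' * (P * a) + P\<^sup>2 * x' * z'"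
      "(g' * z')\<^sup>2 + P * y' * (g' * z') + P\<^sup>2 * x' * z' = z' * (P\<^sup>2 * x' + P * g' * y' + g'\<^sup>2 * z')"
    for P a g' x' y' z' :: complex by (simp_all add: power2_eq_square algebra_simps)
  have "(of_int p)\<^sup>2 * (\<alpha>\<^sup>2 + ipoly y \<theta> * \<alpha> + ipoly (x * z) \<theta>)
      = (of_int p * \<alpha>)\<^sup>2 + of_int p * ipoly y \<theta> * (of_int p * \<alpha>) + (of_int p)\<^sup>2 * ipoly x \<theta> * ipoly z \<theta>"
    unfolding ipoly_simps by (rule eq)
  also have "\<dots> = ipoly z \<theta> * ipoly f \<theta>"
    unfolding p\<alpha> f\<theta> by (rule eq)
  finally have "\<alpha>\<^sup>2 + ipoly y \<theta> * \<alpha> + ipoly (x * z) \<theta> = 0" using root \<open>p \<noteq> 0\<close> by simp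
  then have "algebraic_int \<alpha>"
    by (rule algebraic_int_monic_quadratic[rotated 2])
       (intro algebraic_int_of_int_poly algebraic_int_generator)+
  then have "\<alpha> \<in> ring_of_integers (rat_adjoin \<theta>)"
    using ipoly_div_in_rat_adjoin by (simp add: ring_of_integers_def \<alpha>_def)
  then obtain r where r: "\<alpha> = ipoly r \<theta>" using sub by auto
  then have "ipoly (g * z - [:p:] * r) \<theta> = 0"
    using p\<alpha> by (simp add: ipoly_simps)
  then obtain q where q: "g * z - [:p:] * r = f * q" using ipoly_eq_0_imp_dvd by auto
  \<comment> \<open>Modulo \<open>p\<close> the polynomial \<open>f\<close> reduces to
    \<open>g^2 z\<close>, so the relation \<open>q\<close> becomes the vanishing of
    \<open>g * (z * (1 - g * q))\<close>.\<close>
  have "g * (z * (1 - g * q)) = (g * z - [:p:] * r - f * q) + [:p:] * (r + ([:p:] * x + g * y) * q)"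
    unfolding f_eq by (rule ring_eq(1))
  then have "g * (z * (1 - g * q)) = [:p:] * (r + ([:p:] * x + g * y) * q)" unfolding q by simp
  then have "[:p:] dvd g * (z * (1 - g * q))" by (rule dvdI)
  then have "[:p:] dvd z * (1 - g * q)" by (rule const_poly_dvd_cancel_monic[OF p g(1)])
  moreover have "prime_elem [:p:]" using p by (subst prime_elem_const_poly_iff) (rule prime_imp_prime_elem)
  ultimately have "[:p:] dvd z \<or> [:p:] dvd 1 - g * q" by (metis prime_elem_dvd_multD)
  then show False
  proof
    assume 1: "[:p:] dvd z"
    have "f = [:p:] * ([:p:] * x + g * y) + g\<^sup>2 * z"
      unfolding f_eq by (rule ring_eq(2))
    then have "[:p:] dvd f" using 1 by (simp only: dvd_add dvd_triv_left dvd_mult)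
    then have "p dvd lead_coeff f" unfolding const_poly_dvd_iff by blast
    then show False using p monic by (metis not_prime_unit)
  next
    assume "[:p:] dvd 1 - g * q"
    then obtain v where "1 - g * q = [:p:] * v" by (rule dvdE)
    then have "1 = [:p:] * v + g * q" unfolding diff_eq_eq .
    then have "[:1:] = [:p:] * v + g * q" by (simp only: one_pCons)
    then have "[:1:] \<in> ideal2 [:p:] g" by (rule ideal2_memI)
    then have "p dvd 1" by (rule const_mem_ideal_monic[OF g])
    then show False using p by (metis not_prime_unit)
  qed
qed

text \<open>Multiply the monic equation of \<open>\<beta>\<close> by the \<open>s\<close>-th power
  of the value of \<open>r\<close> and replace \<open>r \<beta>\<close> by \<open>u\<close>: every
  term apart from \<open>u ^ s\<close> contains the factor \<open>r\<close>.\<close>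

lemma homogenized_root:
  assumes "ipoly c \<beta> = 0" "lead_coeff c = 1" "degree c = s" "ipoly r \<theta> * \<beta> = ipoly u \<theta>"
  obtains v where "f dvd u ^ s + r * v" "s > 0"
proof -
  have "s > 0"
  proof (rule ccontr)
    assume "\<not> s > 0"
    then have "c = 1" using monic_degree_0[OF assms(2)] assms(3) by simp
    then show False using assms(1) by simp
  qed
  define v where "v = (\<Sum>i<s. [:coeff c i:] * u ^ i * r ^ (s - Suc i))"
  have "ipoly (u ^ s + r * v) \<theta> = ipoly u \<theta> ^ s + (\<Sum>i<s. of_int (coeff c i) * ipoly u \<theta> ^ i * ipoly r \<theta> ^ (s - i))"
    unfolding v_def ipoly_simps sum_distrib_left
  proof (intro arg_cong2[of _ _ _ _ "(+)"] sum.cong refl)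
    fix i assume "i \<in> {..<s}"
    then have "ipoly r \<theta> ^ (s - i) = ipoly r \<theta> * ipoly r \<theta> ^ (s - Suc i)"
      by (metis Suc_diff_Suc lessThan_iff power_Suc)
    then show "ipoly r \<theta> * (of_int (coeff c i) * ipoly u \<theta> ^ i * ipoly r \<theta> ^ (s - Suc i)) =
        of_int (coeff c i) * ipoly u \<theta> ^ i * ipoly r \<theta> ^ (s - i)" by simp
  qed
  also have "\<dots> = (\<Sum>i<Suc s. of_int (coeff c i) * ipoly u \<theta> ^ i * ipoly r \<theta> ^ (s - i))"
    using assms(2,3) by simp
  also have "\<dots> = ipoly r \<theta> ^ s * (\<Sum>i<Suc s. of_int (coeff c i) * \<beta> ^ i)"
    unfolding sum_distrib_left assms(4)[symmetric]
  proof (intro sum.cong refl)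
    fix i assume "i \<in> {..<Suc s}"
    then have "s = i + (s - i)" by simp
    then have "ipoly r \<theta> ^ s = ipoly r \<theta> ^ i * ipoly r \<theta> ^ (s - i)" by (metis power_add)
    then show "of_int (coeff c i) * (ipoly r \<theta> * \<beta>) ^ i * ipoly r \<theta> ^ (s - i)
        = ipoly r \<theta> ^ s * (of_int (coeff c i) * \<beta> ^ i)"
      by (simp add: power_mult_distrib mult_ac)
  qed
  also have "(\<Sum>i<Suc s. of_int (coeff c i) * \<beta> ^ i) = ipoly c \<beta>"
    by (rule ipoly_altdef[symmetric]) (simp add: assms(3))
  also have "ipoly r \<theta> ^ s * ipoly c \<beta> = 0" using assms(1) by simp
  finally have "f dvd u ^ s + r * v" by (rule ipoly_eq_0_imp_dvd)
  then show thesis using \<open>s > 0\<close> by (rule that)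
qed

text \<open>An integer outside Z[\<theta>] is scaled to an integral \<open>\<beta>\<close>, the
  value of \<open>k / p\<close> at \<open>\<theta>\<close>, such that the \<open>r\<close> with
  \<open>r \<beta>\<close> in Z[\<theta>] form a prime ideal \<open>?J\<close>. Integrality forces
  \<open>\<beta>\<close> to map \<open>?J\<close> into itself, and this pushes both cofactors of
  \<open>f\<close> in \<open>?J\<close> into \<open>?J\<close>.\<close>

lemma ideal_sq_if_not_int_basis:
  assumes "\<not> int_basis (degree f) (\<lambda>i. \<theta> ^ i) (ring_of_integers (rat_adjoin \<theta>))"
  obtains p g where "prime p" "lead_coeff g = 1" "degree g > 0" "f \<in> ideal2_sq [:p:] g"
    "\<forall>r s. r * s \<in> ideal2 [:p:] g \<longrightarrow> r \<in> ideal2 [:p:] g \<or> s \<in> ideal2 [:p:] g"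
proof -
  obtain z where z: "z \<in> ring_of_integers (rat_adjoin \<theta>)" "z \<notin> {ipoly r \<theta> | r. True}"
    using assms unfolding int_basis_powers_iff by blast
  then have "algebraic_int z" "z \<in> rat_adjoin \<theta>" by (auto simp: ring_of_integers_def)
  obtain r0 D0 where D0: "D0 > 0" "z = ipoly r0 \<theta> / of_int D0"
    using rat_adjoin_subset[OF \<open>z \<in> rat_adjoin \<theta>\<close>] .
  define R where "R = (\<lambda>D::nat. D > 0 \<and> (\<exists>r. of_nat D * z = ipoly r \<theta>))"
  have "R (nat D0)" using D0 by (auto simp: R_def field_simps)
  define D where "D = (LEAST D. R D)"
  have "R D" unfolding D_def using \<open>R (nat D0)\<close> by (rule LeastI)
  have least: "\<not> R D'" if "D' < D" for D' using that unfolding D_def by (rule not_less_Least)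
  obtain h where h: "D > 0" "of_nat D * z = ipoly h \<theta>" using \<open>R D\<close> by (auto simp: R_def)
  have "D \<noteq> 1"
  proof
    assume "D = 1"
    then have "z = ipoly h \<theta>" using h(2) by simp
    then show False using z(2) by blast
  qed
  then obtain p' where p': "prime p'" "p' dvd D" using prime_factor_nat[of D] by auto
  define p where "p = int p'"
  have p: "prime p" using p'(1) by (simp add: p_def)
  obtain D' where D': "D = p' * D'" using p'(2) by auto
  have "p' > 1" using p'(1) by (rule prime_gt_1_nat)
  then have "D' < D" "D' > 0" using h(1) D' by auto
  \<comment> \<open>Minimality of \<open>D\<close> keeps \<open>\<alpha>\<close> outside
    Z[\<theta>], while \<open>p\<close> times it lies inside.\<close>
  define \<alpha> where "\<alpha> = of_nat D' * z"
  have p\<alpha>: "of_int p * \<alpha> = ipoly h \<theta>" using h(2) by (simp add: \<alpha>_def D' p_def mult.assoc)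
  have "algebraic_int \<alpha>" unfolding \<alpha>_def
    by (rule algebraic_int_mult[OF _ \<open>algebraic_int z\<close>]) (simp add: int_imp_algebraic_int)
  have ideal: "h \<notin> ideal2 [:p:] f"
  proof
    assume "h \<in> ideal2 [:p:] f"
    then obtain x y where "h = [:p:] * x + f * y" unfolding ideal2_def by blast
    then have "of_int p * \<alpha> = of_int p * ipoly x \<theta>" unfolding p\<alpha>
      using root by (simp add: ipoly_simps del: mult_pCons_left)
    then have "\<alpha> = ipoly x \<theta>" using p by auto
    then have "R D'" using \<open>D' > 0\<close> by (auto simp: R_def \<alpha>_def)
    then show False using least \<open>D' < D\<close> by blast
  qed
  obtain g w where g: "lead_coeff g = 1" "degree g > 0" and w: "w * h \<notin> ideal2 [:p:] f"
    and ann: "\<forall>r. r * (w * h) \<in> ideal2 [:p:] f \<longleftrightarrow> r \<in> ideal2 [:p:] g"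
    and prime: "\<forall>r s. r * s \<in> ideal2 [:p:] g \<longrightarrow> r \<in> ideal2 [:p:] g \<or> s \<in> ideal2 [:p:] g"
    using prime_annihilator_exists[OF p monic ideal] .
  define k where "k = w * h"
  define \<beta> where "\<beta> = ipoly w \<theta> * \<alpha>"
  let ?J = "ideal2 [:p:] g"
  have "f * (w * h) \<in> ideal2 [:p:] f" by (intro ideal2_mult' ideal2_gens)
  then have fJ: "f \<in> ?J" using ann by blast
  have p\<beta>: "of_int p * \<beta> = ipoly k \<theta>"
    using p\<alpha> by (simp add: \<beta>_def k_def ipoly_simps mult_ac)
  have "algebraic_int \<beta>" unfolding \<beta>_def using \<open>algebraic_int \<alpha>\<close>
    by (intro algebraic_int_mult algebraic_int_of_int_poly algebraic_int_generator)
  then obtain c where c: "ipoly c \<beta> = 0" "lead_coeff c = 1"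
    unfolding algebraic_int_altdef_ipoly by blast
  \<comment> \<open>Multiplication by \<open>\<beta>\<close> maps \<open>?J\<close> into itself: the
    homogenised equation of \<open>\<beta>\<close> puts a power of \<open>u\<close> into
    \<open>?J\<close>, which is prime.\<close>
  have stable: "u \<in> ?J" if r: "r \<in> ?J" and u: "r * k = [:p:] * u + f * v" for r u v
  proof -
    have "of_int p * (ipoly r \<theta> * \<beta>) = ipoly (r * k) \<theta>"
      using p\<beta> by (simp add: ipoly_simps mult_ac)
    also have "\<dots> = of_int p * ipoly u \<theta>"
      unfolding u using root by (simp add: ipoly_simps del: mult_pCons_left)
    finally have "ipoly r \<theta> * \<beta> = ipoly u \<theta>" using p by auto
    then obtain t where t: "f dvd u ^ degree c + r * t" "degree c > 0"
      using homogenized_root[OF c refl] by blast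
    have "u ^ degree c + r * t \<in> ?J" using t(1) fJ by (auto elim!: dvdE intro: ideal2_mult')
    then have "u ^ degree c \<in> ?J" using ideal2_diff[OF _ ideal2_mult'[OF r, of t]] by fastforce
    moreover have "u ^ Suc j \<in> ?J \<Longrightarrow> u \<in> ?J" for j
      by (induction j) (use prime in auto)
    ultimately show "u \<in> ?J" using t(2) by (cases "degree c") auto
  qed
  have ring_eq: "g' * (k' - e' * q') = g' * k' - (P * E' + g' * e') * q' + P * (E' * q')"
    "P * x' + f' * q' - f' * q' + P * (E' * q') = P * (x' + E' * q')"
    "k' = (k' - e' * (P * x' + g' * y')) + P * (e' * x' - E' * y') + (P * E' + g' * e') * y'"
    "P * u' + P * v' = P * (u' + v')"
    for P E' e' f' g' k' q' u' v' x' y' :: "int poly" by (simp_all add: algebra_simps)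
  \<comment> \<open>It suffices that \<open>E\<close> and \<open>e\<close> lie in \<open>?J\<close>.
    As \<open>q\<close> does not, primeness reduces this to \<open>E * q\<close> and
    \<open>e * q\<close>, which \<open>stable\<close> controls when applied to the generators
    \<open>g\<close> and \<open>[:p:]\<close>.\<close>
  obtain E e where fE: "f = [:p:] * E + g * e" using fJ unfolding ideal2_def by blast
  have "g * k \<in> ideal2 [:p:] f" using ann unfolding k_def by simp
  then obtain t q where tq: "g * k = [:p:] * t + f * q" unfolding ideal2_def by blast
  have "g * (k - e * q) = g * k - f * q + [:p:] * (E * q)"
    unfolding fE by (rule ring_eq(1))
  also have "\<dots> = [:p:] * (t + E * q)" unfolding tq by (rule ring_eq(2))
  finally have "g * (k - e * q) = [:p:] * (t + E * q)" .
  then have "[:p:] dvd k - e * q"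
    by (rule const_poly_dvd_cancel_monic[OF p g(1) dvdI])
  then obtain t' where t': "k - e * q = [:p:] * t'" by (rule dvdE)
  \<comment> \<open>Otherwise \<open>k\<close> would vanish modulo (p, f), against the choice of
    \<open>w\<close>.\<close>
  have "q \<notin> ?J"
  proof
    assume "q \<in> ?J"
    then obtain x y where q: "q = [:p:] * x + g * y" unfolding ideal2_def by blast
    have "k = (k - e * q) + [:p:] * (e * x - E * y) + f * y"
      unfolding q fE by (rule ring_eq(3))
    then have "k = [:p:] * (t' + (e * x - E * y)) + f * y"
      unfolding t' ring_eq(4) .
    then have "k \<in> ideal2 [:p:] f" by (rule ideal2_memI)
    then show False using w by (simp add: k_def)
  qed
  have "[:p:] * (g * t') = [:p:] * (t + E * q)"
    using \<open>g * (k - e * q) = [:p:] * (t + E * q)\<close> unfolding t' by (simp add: mult_ac)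
  moreover have "[:p:] \<noteq> 0" using p by auto
  ultimately have "g * t' = t + E * q" using mult_left_cancel by blast
  then have "E * q = g * t' - t" by simp
  moreover have "t \<in> ?J" using stable[OF ideal2_gens(2) tq] .
  ultimately have "E * q \<in> ?J" by (simp add: ideal2_diff ideal2_mult')
  then have "E \<in> ?J" using prime \<open>q \<notin> ?J\<close> by blast
  have "k \<in> ?J" using stable[OF ideal2_gens(1), of k 0] by simp
  moreover have "e * q = k - [:p:] * t'" using t' by (simp add: algebra_simps)
  ultimately have "e * q \<in> ?J" by (simp only:) (intro ideal2_diff ideal2_mult' ideal2_gens)
  then have "e \<in> ?J" using prime \<open>q \<notin> ?J\<close> by blast
  have "f \<in> ideal2_sq [:p:] g" unfolding fE
    by (intro ideal2_sq_add ideal2_mult_sq ideal2_gens \<open>E \<in> ?J\<close> \<open>e \<in> ?J\<close>)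
  with p g show thesis using prime by (rule that)
qed

end

text \<open>\<open>monogenic\<close> quantifies over the complex roots, so refuting it takes an
  actual root, supplied by the fundamental theorem of algebra.\<close>

lemma not_monogenic_if_ideal_sq:
  assumes "prime p" "lead_coeff g = 1" "degree g > 0" "f \<in> ideal2_sq [:p:] g"
  shows "\<not> monogenic f"
proof
  assume f: "monogenic f"
  have "degree f \<noteq> 0"
  proof
    assume "degree f = 0"
    then have "f = 1" using f monic_degree_0[of f] unfolding monogenic_def by simp
    then show False using f unfolding monogenic_def by simp
  qed
  then have "degree (map_poly of_int f :: complex poly) \<noteq> 0" by simp
  then obtain \<theta> :: complex where \<theta>: "ipoly f \<theta> = 0"
    using fundamental_theorem_of_algebra[of "map_poly of_int f :: complex poly"]
    by (auto simp: constant_degree)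
  then interpret integral_generator f \<theta>
    using f unfolding monogenic_def by unfold_locales auto
  show False using not_int_basis_if_ideal_sq[OF assms] f \<theta> unfolding monogenic_def by blast
qed

lemma monogenicI_ideal_sq:
  assumes "lead_coeff f = 1" "irreducible (map_poly rat_of_int f)"
    and "\<And>p g. prime p \<Longrightarrow> lead_coeff g = 1 \<Longrightarrow> degree g > 0 \<Longrightarrow>
      \<forall>r s. r * s \<in> ideal2 [:p:] g \<longrightarrow> r \<in> ideal2 [:p:] g \<or> s \<in> ideal2 [:p:] g \<Longrightarrow>
      f \<notin> ideal2_sq [:p:] g"
  shows "monogenic f"
  unfolding monogenic_def
proof (intro conjI allI impI)
  fix \<theta> :: complex assume "poly (map_poly of_int f) \<theta> = 0"
  then interpret integral_generator f \<theta> using assms by unfold_locales auto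
  show "int_basis (degree f) (\<lambda>i. \<theta> ^ i) (ring_of_integers (rat_adjoin \<theta>))"
  proof (rule ccontr)
    assume "\<not> ?thesis"
    then show False by (rule ideal_sq_if_not_int_basis) (use assms(3) in blast)
  qed
qed (use assms in auto)

section \<open>Irreducibility and power expansions\<close>

text \<open>At the least \<open>i\<close> where \<open>p\<close> does not divide
  \<open>coeff g i\<close>, the product has coefficient \<open>coeff g i * coeff h 0\<close> modulo
  \<open>p\<close>; and \<open>i\<close> is below the degree of the product because \<open>h\<close>
  is not constant.\<close>

lemma eisenstein_criterion_no_factorization:
  fixes g h :: "int poly"
  assumes p: "prime p" and lc: "lead_coeff (g * h) = 1" and deg: "degree h > 0"
    and low: "\<And>i. i < degree (g * h) \<Longrightarrow> p dvd coeff (g * h) i"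
    and h0: "\<not> p dvd coeff h 0"
  shows False
proof -
  have "lead_coeff g * lead_coeff h = 1" using lc by (simp add: lead_coeff_mult)
  then have "\<not> p dvd lead_coeff g" using p by (metis dvd_mult2 not_prime_unit)
  define i where "i = (LEAST i. \<not> p dvd coeff g i)"
  have i: "\<not> p dvd coeff g i" unfolding i_def by (rule LeastI) fact
  have least: "p dvd coeff g j" if "j < i" for j using that not_less_Least unfolding i_def by blast
  have "g \<noteq> 0" "h \<noteq> 0" using lc by auto
  have "i \<le> degree g" by (rule le_degree) (use i in auto)
  then have "i < degree (g * h)" using deg \<open>g \<noteq> 0\<close> \<open>h \<noteq> 0\<close> by (simp add: degree_mult_eq)
  then have "p dvd coeff (g * h) i" by (rule low)
  also have "coeff (g * h) i = (\<Sum>j<i. coeff g j * coeff h (i - j)) + coeff g i * coeff h 0"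
    by (simp add: coeff_mult lessThan_Suc_atMost[symmetric])
  finally have "p dvd (\<Sum>j<i. coeff g j * coeff h (i - j)) + coeff g i * coeff h 0" .
  moreover have "p dvd (\<Sum>j<i. coeff g j * coeff h (i - j))"
    by (intro dvd_sum dvd_mult2 least) simp
  ultimately have "p dvd coeff g i * coeff h 0" by (simp add: dvd_add_right_iff)
  then show False using p i h0 prime_dvd_mult_iff by blast
qed

text \<open>By Gauss's lemma a rational factorisation may be taken over the integers. As
  \<open>p^2\<close> does not divide the constant coefficient, one factor has constant coefficient
  prime to \<open>p\<close> and serves as the \<open>h\<close> of the previous lemma.\<close>

lemma eisenstein_criterion:
  fixes f :: "int poly"
  assumes p: "prime p" and monic: "lead_coeff f = 1" and deg: "degree f > 0"
    and low: "\<And>i. i < degree f \<Longrightarrow> p dvd coeff f i" and sq: "\<not> p\<^sup>2 dvd coeff f 0"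
  shows "irreducible (map_poly rat_of_int f)"
proof (rule irreducibleI)
  show "map_poly rat_of_int f \<noteq> 0" using deg by auto
  show "\<not> is_unit (map_poly rat_of_int f)" using deg by (auto simp: is_unit_iff_degree)
  fix G H assume GH: "map_poly rat_of_int f = G * H"
  show "is_unit G \<or> is_unit H"
  proof (rule ccontr)
    assume nu: "\<not> ?thesis"
    have nz: "G \<noteq> 0" "H \<noteq> 0" using GH deg by auto
    then have dGH: "degree G > 0" "degree H > 0" using nu by (auto simp: is_unit_iff_degree)
    obtain D1 :: int and g1 where g1: "D1 > 0" "Polynomial.smult (of_int D1) G = map_poly of_int g1"
      by (rule clear_denominators)
    obtain D2 :: int and h1 where h1: "D2 > 0" "Polynomial.smult (of_int D2) H = map_poly of_int h1"
      by (rule clear_denominators)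
    have "map_poly rat_of_int (g1 * h1) = Polynomial.smult (of_int D1) G * Polynomial.smult (of_int D2) H"
      unfolding g1(2) h1(2) by (simp add: hom_distribs)
    also have "\<dots> = map_poly rat_of_int (Polynomial.smult (D1 * D2) f)"
      by (simp add: GH hom_distribs mult.commute)
    finally have eq: "g1 * h1 = Polynomial.smult (D1 * D2) f"
      by (rule of_int_poly_hom.injectivity)
    define g where "g = primitive_part g1"
    define h where "h = primitive_part h1"
    have g1': "g1 = Polynomial.smult (content g1) g" and h1': "h1 = Polynomial.smult (content h1) h"
      by (simp_all add: g_def h_def)
    \<comment> \<open>A monic polynomial has content 1, so the contents of \<open>g1\<close> and
      \<open>h1\<close> multiply to exactly \<open>D1 * D2\<close>, which then cancels.\<close>
    have "content f dvd lead_coeff f" by (rule content_dvd_coeff)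
    then have "is_unit (content f)" unfolding monic .
    then have "content f = 1" by (simp only: is_unit_content_iff)
    then have "content (g1 * h1) = D1 * D2" unfolding eq using g1(1) h1(1) by simp
    then have c: "content g1 * content h1 = D1 * D2" by (simp add: content_mult)
    have "Polynomial.smult (D1 * D2) (g * h) = Polynomial.smult (D1 * D2) f"
    proof -
      have "Polynomial.smult (content g1 * content h1) (g * h)
          = Polynomial.smult (content g1) g * Polynomial.smult (content h1) h"
        by (simp add: mult.commute)
      then show ?thesis unfolding g1'[symmetric] h1'[symmetric] c eq .
    qed
    moreover have "D1 * D2 \<noteq> 0" using g1(1) h1(1) by simp
    ultimately have "coeff f i = coeff (g * h) i" for i
      by (metis coeff_smult mult_left_cancel)
    then have f: "f = g * h" by (intro poly_eqI)
    have "degree (map_poly rat_of_int g1) = degree G" "degree (map_poly rat_of_int h1) = degree H"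
      unfolding g1(2)[symmetric] h1(2)[symmetric] using g1(1) h1(1) by simp_all
    then have d: "degree g > 0" "degree h > 0" using dGH by (simp_all add: g_def h_def)
    have c0: "coeff f 0 = coeff g 0 * coeff h 0" by (simp add: f coeff_mult)
    show False
    proof (cases "p dvd coeff h 0")
      case False
      then show False
        using eisenstein_criterion_no_factorization[of p g h] p d monic low unfolding f by blast
    next
      case True
      then have "\<not> p dvd coeff g 0" using sq unfolding c0 power2_eq_square by (metis mult_dvd_mono)
      then show False
        using eisenstein_criterion_no_factorization[of p h g] p d monic low
        unfolding f mult.commute[of h g] by blast
    qed
  qed
qed

section \<open>Expansions modulo a square and modulo a prime\<close>

lemma power_add_mod_square:
  fixes a h :: "'a :: comm_ring_1"
  obtains e where "(a + h) ^ j = a ^ j + of_nat j * a ^ (j - 1) * h + h\<^sup>2 * e"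
proof -
  have "\<exists>e. (a + h) ^ j = a ^ j + of_nat j * a ^ (j - 1) * h + h\<^sup>2 * e"
  proof (induction j)
    case 0
    show ?case by (intro exI[of _ 0]) simp
  next
    case (Suc j)
    then obtain e where e: "(a + h) ^ j = a ^ j + of_nat j * a ^ (j - 1) * h + h\<^sup>2 * e" by blast
    \<comment> \<open>At \<open>j = 0\<close> the truncated exponent \<open>j - 1\<close> is
      harmless, since the factor \<open>of_nat j\<close> vanishes.\<close>
    have *: "of_nat j * a ^ (j - 1) * a = of_nat j * a ^ j" by (cases j) simp_all
    have "(a + h) ^ Suc j = (a ^ j + of_nat j * a ^ (j - 1) * h + h\<^sup>2 * e) * (a + h)"
      unfolding power_Suc2 e ..
    also have "\<dots> = a ^ j * a + a ^ j * h + (of_nat j * a ^ (j - 1) * a) * h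
        + h\<^sup>2 * (of_nat j * a ^ (j - 1) + e * (a + h))"
      by (simp add: algebra_simps power2_eq_square)
    also have "\<dots> = a ^ Suc j + of_nat (Suc j) * a ^ (Suc j - 1) * h
        + h\<^sup>2 * (of_nat j * a ^ (j - 1) + e * (a + h))"
      unfolding * by (simp add: algebra_simps)
    finally show ?case by blast
  qed
  then show thesis using that by blast
qed

lemma prime_power_add:
  fixes u v :: "'a :: comm_ring_1"
  assumes "prime p"
  obtains w where "(u + v) ^ p = u ^ p + v ^ p + of_nat p * w"
proof -
  have "p > 0" using assms by (rule prime_gt_0_nat)
  have "\<exists>w. (\<Sum>i\<in>A. of_nat (p choose i) * u ^ i * v ^ (p - i)) = of_nat p * w" if "A \<subseteq> {0<..<p}" for A
  proof -
    have "finite A" using that finite_subset by blast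
    then show ?thesis using that
    proof (induction A)
      case empty
      show ?case by (intro exI[of _ 0]) simp
    next
      case (insert i A)
      then obtain w where w: "(\<Sum>i\<in>A. of_nat (p choose i) * u ^ i * v ^ (p - i)) = of_nat p * w" by auto
      have "p dvd p choose i" using insert.prems assms by (intro dvd_choose_prime) auto
      then obtain c where c: "p choose i = p * c" by auto
      have "(\<Sum>i\<in>insert i A. of_nat (p choose i) * u ^ i * v ^ (p - i))
          = of_nat p * (of_nat c * u ^ i * v ^ (p - i) + w)"
        unfolding sum.insert[OF insert.hyps] w c by (simp add: distrib_left mult.assoc)
      then show ?case by blast
    qed
  qed
  then obtain w where w: "(\<Sum>i\<in>{0<..<p}. of_nat (p choose i) * u ^ i * v ^ (p - i)) = of_nat p * w" by blast
  have "{..p} = insert 0 (insert p {0<..<p})" using \<open>p > 0\<close> by auto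
  then have "(u + v) ^ p = u ^ p + v ^ p + of_nat p * w"
    unfolding binomial_ring using \<open>p > 0\<close> w by (simp add: add_ac)
  then show thesis by (rule that)
qed

section \<open>The primes dividing b or m\<close>

lemma poly_F_eq:
  "poly_F n b m k = monom 1 k ^ n + [:b:] * (\<Sum>i<n. ([:m\<^sup>2:] * monom 1 k) ^ i)"
proof -
  have "(\<Sum>j=1..n. (monom (m\<^sup>2) k :: int poly) ^ (n - j)) = (\<Sum>i<n. monom (m\<^sup>2) k ^ i)"
    by (rule sum.reindex_bij_witness[of _ "\<lambda>i. n - i" "\<lambda>j. n - j"]) auto
  moreover have "monom (m\<^sup>2) k = [:m\<^sup>2:] * monom 1 k" by (simp add: smult_monom)
  moreover have "monom 1 (n * k) = (monom 1 k :: int poly) ^ n"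
    by (simp add: monom_power mult.commute)
  ultimately show ?thesis unfolding poly_F_def by simp
qed

text \<open>All terms beyond \<open>x^(nk) + b\<close> share the factor \<open>b m^2 x^k\<close>;
  this one form serves the primes dividing \<open>b\<close> and those dividing
  \<open>m\<close>.\<close>

lemma poly_F_eq_Suc:
  assumes "n > 0"
  shows "\<exists>S. poly_F n b m k = monom 1 k ^ n + [:b:] + [:b:] * [:m\<^sup>2:] * monom 1 k * S"
proof -
  obtain n' where n: "n = Suc n'" using assms by (cases n) auto
  have eq: "(\<Sum>i<Suc n'. z ^ i) = 1 + z * (\<Sum>i<n'. z ^ i)" for z :: "int poly"
    by (subst sum.lessThan_Suc_shift) (simp add: sum_distrib_left)
  have ring: "y + B * (1 + M * x * S) = y + B + B * M * x * S" for y B M x S :: "int poly"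
    by (simp add: algebra_simps)
  show ?thesis unfolding poly_F_eq unfolding n eq ring by blast
qed

text \<open>The factor \<open>m^2 y - 1\<close> with \<open>y = x^k\<close> collapses the geometric
  sum to \<open>m^(2n) y^n - 1\<close>.\<close>

lemma geometric_poly_F:
  "([:m\<^sup>2:] * monom 1 k - 1) * poly_F n b m k =
     [:m\<^sup>2:] * monom 1 k ^ Suc n - [:1 - b * m ^ (2 * n):] * monom 1 k ^ n - [:b:]"
proof -
  have ring: "(M * y - 1) * (z + B * S) = M * (y * z) - z + B * ((M * y - 1) * S)"
    "M * (y * z) - z + B * (w * z - 1) = M * (y * z) - (1 - B * w) * z - B"
    for M y z B S w :: "int poly" by (simp_all add: algebra_simps)
  have "[:m\<^sup>2:] ^ n = [:m ^ (2 * n):]"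
    by (simp only: poly_const_pow power_mult)
  then have "[:b:] * [:m\<^sup>2:] ^ n = [:b * m ^ (2 * n):]" by simp
  then have U: "[:1 - b * m ^ (2 * n):] = 1 - [:b:] * [:m\<^sup>2:] ^ n"
    by (simp only: one_pCons diff_pCons diff_0_right)
  show ?thesis
    unfolding poly_F_eq ring(1) power_diff_1_eq[symmetric] power_mult_distrib U ring(2) power_Suc ..
qed

lemma monom_base_power:
  fixes m :: int
  shows "([:m\<^sup>2:] * monom 1 k) ^ j = monom (m ^ (2 * j)) (j * k)"
proof -
  have "[:m\<^sup>2:] * monom 1 k = monom (m\<^sup>2) k" by (simp add: smult_monom)
  then show ?thesis by (simp only: monom_power power_mult mult.commute[of k j])
qed

lemma coeff_poly_F:
  assumes "k > 0" "i < n * k"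
  shows "coeff (poly_F n b m k) i = b * (\<Sum>j<n. if j * k = i then m ^ (2 * j) else 0)"
proof -
  have "coeff (([:m\<^sup>2:] * monom 1 k) ^ j) i = (if j * k = i then m ^ (2 * j) else 0)" for j
    unfolding monom_base_power by simp
  moreover have "(monom 1 k :: int poly) ^ n = monom 1 (n * k)"
    by (simp add: monom_power mult.commute)
  ultimately show ?thesis
    using assms by (simp add: poly_F_eq coeff_sum)
qed

lemma degree_poly_F:
  assumes "k > 0" "n > 0"
  shows "degree (poly_F n b m k) = n * k" "lead_coeff (poly_F n b m k) = 1"
proof -
  have deg: "degree (([:m\<^sup>2:] * monom 1 k :: int poly) ^ j) < n * k" if "j < n" for j
  proof -
    have "degree (([:m\<^sup>2:] * monom 1 k :: int poly) ^ j) \<le> j * k"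
      unfolding monom_base_power by (rule degree_monom_le)
    also have "\<dots> < n * k" using that assms by simp
    finally show ?thesis .
  qed
  have "degree (\<Sum>i<n. ([:m\<^sup>2:] * monom 1 k :: int poly) ^ i) < n * k"
    using assms by (intro degree_sum_less deg) auto
  then have low: "degree ([:b:] * (\<Sum>i<n. ([:m\<^sup>2:] * monom 1 k :: int poly) ^ i)) < n * k"
    using assms by simp
  have Yn: "(monom 1 k :: int poly) ^ n = monom 1 (n * k)" by (simp add: monom_power mult.commute)
  show d: "degree (poly_F n b m k) = n * k"
    unfolding poly_F_eq Yn by (subst degree_add_eq_left) (use low in \<open>simp_all add: degree_monom_eq\<close>)
  show "lead_coeff (poly_F n b m k) = 1"
    unfolding d unfolding poly_F_eq Yn coeff_add coeff_eq_0[OF low] by simp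
qed

text \<open>Eisenstein at a prime dividing \<open>b\<close>: the lower coefficients are multiples of
  \<open>b\<close>, and the constant one is the squarefree \<open>b\<close>.\<close>

lemma irreducible_poly_F:
  assumes "b \<ge> 2" "squarefree b" "k > 0" "n > 0"
  shows "irreducible (map_poly rat_of_int (poly_F n b m k))"
proof -
  obtain p where p: "prime p" "p dvd b"
    using assms(1) prime_factor_int[of b] by auto
  have "\<not> p\<^sup>2 dvd b" using assms(2) p(1) unfolding squarefree_def by (metis not_prime_unit)
  moreover have "coeff (poly_F n b m k) 0 = b"
  proof -
    have "(\<Sum>j<n. if j * k = 0 then m ^ (2 * j) else 0) = (\<Sum>j<n. if j = 0 then 1 else 0)"
      using assms(3) by (intro sum.cong) auto
    also have "\<dots> = (1 :: int)" using assms(4) by simp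
    finally show ?thesis using assms(3,4) by (simp add: coeff_poly_F)
  qed
  ultimately show ?thesis
    using p assms degree_poly_F(2)[of k n b m]
    by (intro eisenstein_criterion[of p]) (simp_all add: degree_poly_F(1) coeff_poly_F)
qed

text \<open>The two polynomials differ by a multiple of \<open>m^2\<close>, hence of
  \<open>p^2\<close>.\<close>

lemma poly_F_in_ideal_sq_iff:
  assumes "p dvd m" "n > 0"
  shows "poly_F n b m k \<in> ideal2_sq [:p:] g \<longleftrightarrow> monom 1 (n * k) + [:b:] \<in> ideal2_sq [:p:] g"
proof -
  obtain S where S: "poly_F n b m k = monom 1 k ^ n + [:b:] + [:b:] * [:m\<^sup>2:] * monom 1 k * S"
    using poly_F_eq_Suc[OF assms(2)] by blast
  obtain d where "m = p * d" using assms(1) by auto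
  then have m2: "[:m\<^sup>2:] = [:p:] * [:p:] * [:d\<^sup>2:]" by (simp add: power2_eq_square mult_ac)
  have ring: "B * (P * P * D) * y * T = (B * D * y * T) * (P * P)" for B P D y T :: "int poly"
    by (simp only: mult_ac)
  have "[:b:] * [:m\<^sup>2:] * monom 1 k * S \<in> ideal2_sq [:p:] g"
    unfolding m2 ring by (intro ideal2_sq_mult ideal2_mult_sq ideal2_gens)
  moreover have "monom 1 k ^ n = (monom 1 (n * k) :: int poly)" by (simp add: monom_power mult.commute)
  ultimately show ?thesis unfolding S
    using ideal2_sq_add ideal2_sq_diff by (metis add_diff_cancel_right')
qed

text \<open>Write \<open>x^N\<close> as \<open>h - b\<close> with \<open>h\<close> in the ideal and
  raise to the power \<open>q\<close>: the linear term contains \<open>q h\<close> and the rest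
  \<open>h^2\<close>, so only the constant survives.\<close>

lemma binomial_mod_ideal_sq:
  fixes b :: int
  assumes h: "monom 1 N + [:b:] \<in> ideal2 [:int q:] g"
  shows "monom 1 (q * N) + [:b:] - [:(- b) ^ q + b:] \<in> ideal2_sq [:int q:] g"
proof -
  define h where "h = monom 1 N + [:b:]"
  obtain e where e: "([:- b:] + h) ^ q = [:- b:] ^ q + of_nat q * [:- b:] ^ (q - 1) * h + h\<^sup>2 * e"
    using power_add_mod_square .
  have "monom 1 (q * N) = (monom 1 N :: int poly) ^ q" by (simp add: monom_power mult.commute)
  also have "monom 1 N = [:- b:] + h" by (simp add: h_def)
  finally have y: "monom 1 (q * N) = [:- b:] ^ q + of_nat q * [:- b:] ^ (q - 1) * h + h\<^sup>2 * e"
    unfolding e .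
  have c: "[:(- b) ^ q + b:] = [:- b:] ^ q + [:b:]" by (simp add: poly_const_pow)
  have q: "(of_nat q :: int poly) = [:int q:]" by (simp add: of_nat_poly)
  have ring: "x + u * v * w + w\<^sup>2 * z + B - (x + B) = v * (u * w) + z * (w * w)"
    for u v w x z B :: "int poly" by (simp add: algebra_simps power2_eq_square)
  show ?thesis
    unfolding y c q ring using h unfolding h_def[symmetric]
    by (intro ideal2_sq_add ideal2_sq_mult ideal2_mult_sq ideal2_gens)
qed

text \<open>With \<open>g = x^N + b\<close> the surviving constant is a multiple of
  \<open>q^2\<close>. This supplies the ideal that refutes monogenicity.\<close>

lemma binomial_in_ideal_sq:
  fixes b :: int
  assumes "(int q)\<^sup>2 dvd (- b) ^ q + b"
  shows "monom 1 (q * N) + [:b:] \<in> ideal2_sq [:int q:] (monom 1 N + [:b:])"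
proof -
  obtain d where "(- b) ^ q + b = (int q)\<^sup>2 * d" using assms by auto
  then have "[:(- b) ^ q + b:] = [:d:] * ([:int q:] * [:int q:])" by (simp add: power2_eq_square mult_ac)
  also have "\<dots> \<in> ideal2_sq [:int q:] (monom 1 N + [:b:])"
    by (intro ideal2_sq_mult ideal2_mult_sq ideal2_gens)
  finally show ?thesis
    using ideal2_sq_add[OF binomial_mod_ideal_sq[OF ideal2_gens(2)]] by (metis diff_add_cancel)
qed

lemma fermat_little_int:
  assumes "prime q" "b \<ge> 0"
  shows "int q dvd b ^ q - b"
proof -
  have "int q dvd int a ^ q - int a" for a
  proof (induction a)
    case 0
    show ?case using prime_gt_0_nat[OF assms(1)] by (simp add: zero_power)
  next
    case (Suc a)
    obtain w where w: "(int a + 1) ^ q = int a ^ q + 1 ^ q + of_nat q * w"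
      using prime_power_add[OF assms(1)] .
    have "int (Suc a) ^ q - int (Suc a) = (int a ^ q - int a) + int q * w"
      using w by (simp add: add.commute)
    then show ?case using Suc by (simp only: dvd_add dvd_triv_left)
  qed
  from this[of "nat b"] show ?thesis using assms(2) by simp
qed

text \<open>Since \<open>g\<close> is monic and nonconstant the ideal is proper, so being prime it
  is maximal.\<close>

locale prime_ideal2 =
  fixes p :: int and g :: "int poly"
  assumes p: "prime p" and g: "lead_coeff g = 1" "degree g > 0"
    and prime_ideal: "\<forall>r s. r * s \<in> ideal2 [:p:] g \<longrightarrow> r \<in> ideal2 [:p:] g \<or> s \<in> ideal2 [:p:] g"
begin

abbreviation "J \<equiv> ideal2 [:p:] g"
abbreviation "J2 \<equiv> ideal2_sq [:p:] g"

lemma const_in_J_iff: "[:c:] \<in> J \<longleftrightarrow> p dvd c"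
proof
  show "[:c:] \<in> J \<Longrightarrow> p dvd c" by (rule const_mem_ideal_monic[OF g])
  assume "p dvd c"
  then obtain d where "c = p * d" by auto
  then have "[:c:] = [:p:] * [:d:]" by simp
  then show "[:c:] \<in> J" using ideal2_mult'[OF ideal2_gens(1)] by metis
qed

lemma const_in_J2: "[:c:] \<in> J2 \<Longrightarrow> p\<^sup>2 dvd c"
  by (rule const_mem_ideal_sq_monic[OF g])

lemma mult_in_J_iff: "u * v \<in> J \<longleftrightarrow> u \<in> J \<or> v \<in> J"
  using prime_ideal ideal2_mult ideal2_mult' by blast

lemma one_notin_J: "1 \<notin> J"
  using const_in_J_iff[of 1] p by (metis not_prime_unit one_pCons)

lemma power_in_J: "u ^ j \<in> J \<Longrightarrow> u \<in> J"
  by (induction j) (auto simp: one_notin_J mult_in_J_iff)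

text \<open>Modulo \<open>b\<close> the polynomial is a power of \<open>x^k\<close>, so
  \<open>x^k\<close> lies in \<open>J\<close>. As \<open>n \<ge> 2\<close>, every term except the
  constant \<open>b\<close> is then in \<open>J2\<close>, and \<open>b\<close> would be too.\<close>

lemma poly_F_notin_J2_if_dvd_b:
  assumes "p dvd b" "\<not> p\<^sup>2 dvd b" "n \<ge> 2"
  shows "poly_F n b m k \<notin> J2"
proof
  assume F: "poly_F n b m k \<in> J2"
  let ?Y = "monom 1 k :: int poly"
  obtain S where S: "poly_F n b m k = ?Y ^ n + [:b:] + [:b:] * [:m\<^sup>2:] * ?Y * S"
    using poly_F_eq_Suc[of n b m k] assms(3) by auto
  have B: "[:b:] \<in> J" using assms(1) const_in_J_iff by blast
  have "?Y ^ n = poly_F n b m k - [:b:] - [:b:] * ([:m\<^sup>2:] * ?Y * S)"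
    unfolding S mult.assoc by (simp only: add_diff_cancel_right' add_diff_cancel_left' diff_diff_eq2 add.assoc)
  also have "\<dots> \<in> J" by (intro ideal2_diff ideal2_mult' B ideal2_sq_subset F)
  finally have Y: "?Y \<in> J" by (rule power_in_J)
  obtain n' where n: "n = Suc (Suc n')" using assms(3) by (metis Suc_le_D numeral_2_eq_2 Suc_le_mono)
  have ring: "B = (y * (y * z) + B + B * M * y * T) - y * (y * z) - B * (y * (M * T))"
    for B M T y z :: "int poly" by (simp add: algebra_simps)
  have "[:b:] = poly_F n b m k - ?Y * (?Y * ?Y ^ n') - [:b:] * (?Y * ([:m\<^sup>2:] * S))"
    unfolding S unfolding n power_Suc by (rule ring)
  also have "\<dots> \<in> J2" by (intro ideal2_sq_diff F ideal2_mult_sq Y B ideal2_mult')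
  finally show False using const_in_J2 assms(2) by blast
qed

text \<open>If \<open>q\<close> did not divide \<open>N\<close>, the derivative would put
  \<open>x^N\<close>, and with it \<open>b\<close>, into \<open>J\<close>. With
  \<open>N = q * N1\<close>, Frobenius and Fermat give \<open>x^N + b = (x^N1 + b)^q\<close> modulo
  \<open>q\<close>, so \<open>x^N1 + b\<close> is in \<open>J\<close> and the binomial expansion
  leaves the constant.\<close>

lemma binomial_in_J2:
  assumes q: "p = int q" and b: "\<not> p dvd b" "b \<ge> 0" and N: "N > 0" and mem: "monom 1 N + [:b:] \<in> J2"
  shows "q dvd N \<and> p\<^sup>2 dvd (- b) ^ q + b"
proof -
  have pq: "prime q" using p q by simp
  have B: "[:b:] \<notin> J" using b(1) const_in_J_iff by blast
  have "q dvd N"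
  proof (rule ccontr)
    assume "\<not> q dvd N"
    then have "[:int N:] \<notin> J" using const_in_J_iff q by simp
    have "pderiv (monom 1 N + [:b:]) \<in> J" using mem by (rule pderiv_ideal_sq)
    moreover have "pderiv (monom 1 N + [:b:]) = [:int N:] * monom 1 (N - 1)"
      by (simp add: pderiv_add pderiv_monom smult_monom)
    ultimately have "monom 1 (N - 1) \<in> J" using \<open>[:int N:] \<notin> J\<close> by (simp only: mult_in_J_iff) simp
    then have "monom 1 (N - 1) * monom 1 1 \<in> J" by (rule ideal2_mult')
    moreover have "monom 1 (N - 1) * monom 1 1 = (monom 1 N :: int poly)" using N by (simp add: mult_monom)
    ultimately have "monom 1 N \<in> J" by simp
    then have "(monom 1 N + [:b:]) - monom 1 N \<in> J" using ideal2_sq_subset[OF mem] by (rule ideal2_diff[rotated])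
    then show False using B by simp
  qed
  then obtain N1 where N1: "N = q * N1" by auto
  define y where "y = (monom 1 N1 :: int poly)"
  have y: "monom 1 N = y ^ q" by (simp add: y_def N1 monom_power mult.commute)
  obtain w where w: "(y + [:b:]) ^ q = y ^ q + [:b:] ^ q + of_nat q * w"
    using prime_power_add[OF pq] .
  have "(of_nat q :: int poly) = [:p:]" by (simp add: of_nat_poly q)
  moreover have "[:b:] ^ q = [:b:] + [:b ^ q - b:]" by (simp add: poly_const_pow)
  ultimately have "(y + [:b:]) ^ q = (monom 1 N + [:b:]) + [:b ^ q - b:] + [:p:] * w"
    unfolding w y by (simp only: add.assoc)
  also have "\<dots> \<in> J"
  proof -
    have "[:b ^ q - b:] \<in> J" using fermat_little_int[OF pq b(2)] const_in_J_iff q by blast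
    then show ?thesis
      by (rule ideal2_add[OF ideal2_add[OF ideal2_sq_subset[OF mem]] ideal2_mult'[OF ideal2_gens(1)]])
  qed
  finally have "y + [:b:] \<in> J" by (rule power_in_J)
  then have "monom 1 N + [:b:] - [:(- b) ^ q + b:] \<in> J2"
    unfolding y_def q N1 by (rule binomial_mod_ideal_sq)
  then have "(monom 1 N + [:b:]) - (monom 1 N + [:b:] - [:(- b) ^ q + b:]) \<in> J2"
    by (rule ideal2_sq_diff[OF mem])
  moreover have "(monom 1 N + [:b:]) - (monom 1 N + [:b:] - [:(- b) ^ q + b:]) = [:(- b) ^ q + b:]"
    by (rule diff_diff_eq2[THEN trans]) (rule add_diff_cancel_left')
  ultimately have "[:(- b) ^ q + b:] \<in> J2" by simp
  then show ?thesis using const_in_J2 \<open>q dvd N\<close> by blast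
qed

end

section \<open>The primes not dividing bm\<close>

text \<open>The remainder \<open>e\<close> is homogeneous of degree \<open>N\<close> in
  \<open>a\<close> and \<open>\<delta>\<close>. The factor \<open>\<delta>^2\<close> is kept
  explicit to cancel the denominator of \<open>\<D>\<close>.\<close>

lemma power_diff_high_divisibility:
  fixes a \<delta> p :: int
  assumes "p dvd a" "p dvd \<delta>"
  obtains e where "(a - \<delta>) ^ (N + 2) = a ^ (N + 2) - int (N + 2) * \<delta> * a ^ (N + 1) + \<delta>\<^sup>2 * e" "p ^ N dvd e"
proof -
  have "\<exists>e. (a - \<delta>) ^ (N + 2) = a ^ (N + 2) - int (N + 2) * \<delta> * a ^ (N + 1) + \<delta>\<^sup>2 * e \<and> p ^ N dvd e"
  proof (induction N)
    case 0
    show ?case by (intro exI[of _ 1]) (simp add: power2_eq_square algebra_simps)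
  next
    case (Suc N)
    then obtain e where e: "(a - \<delta>) ^ (N + 2) = a ^ (N + 2) - int (N + 2) * \<delta> * a ^ (N + 1) + \<delta>\<^sup>2 * e"
      "p ^ N dvd e" by blast
    have "(a - \<delta>) ^ (Suc N + 2) = (a - \<delta>) * (a - \<delta>) ^ (N + 2)" by simp
    also have "\<dots> = a ^ (Suc N + 2) - int (Suc N + 2) * \<delta> * a ^ (Suc N + 1)
        + \<delta>\<^sup>2 * ((a - \<delta>) * e + int (N + 2) * a ^ (N + 1))"
      unfolding e(1) by (simp add: power2_eq_square algebra_simps)
    finally have "(a - \<delta>) ^ (Suc N + 2) = a ^ (Suc N + 2) - int (Suc N + 2) * \<delta> * a ^ (Suc N + 1)
        + \<delta>\<^sup>2 * ((a - \<delta>) * e + int (N + 2) * a ^ (N + 1))" .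
    moreover have "p ^ Suc N dvd (a - \<delta>) * e"
      using mult_dvd_mono[OF dvd_diff[OF assms] e(2)] by simp
    moreover have "p ^ Suc N dvd int (N + 2) * a ^ (N + 1)"
      using dvd_power_same[OF assms(1), of "N + 1"] by simp
    ultimately show ?case by (metis dvd_add)
  qed
  then show thesis using that by blast
qed

lemma \<D>_mult_denominator:
  assumes "n \<ge> 1"
  shows "\<D> n b m * (1 + b * m ^ (2 * n) * int n)\<^sup>2 =
    int n ^ n * (1 - b * m ^ (2 * n)) ^ (n + 1) + b * m ^ (2 * n) * (int n + 1) ^ (n + 1)"
  unfolding \<D>_def using \<D>_denominator_dvd[OF assms] by (rule dvd_div_mult_self)

text \<open>Multiplying the numerator by \<open>n\<close> and expanding in \<open>\<delta>\<close>
  shows that \<open>n \<D>\<close> is the remainder \<open>e\<close> of the previous lemma at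
  \<open>a = n + 1\<close>, a multiple of \<open>p^(n-1)\<close>. Here \<open>n \<ge> 3\<close>
  gives \<open>p^2\<close>, and \<open>p\<close> is prime to \<open>n\<close> as it divides
  \<open>n + 1\<close>.\<close>

lemma prime_square_dvd_\<D>:
  assumes p: "prime p" and n: "n \<ge> 3" and b: "b \<ge> 0"
    and dvd: "p dvd int n + 1" "p dvd 1 + b * m ^ (2 * n) * int n"
  shows "p\<^sup>2 dvd \<D> n b m"
proof -
  define B where "B = b * m ^ (2 * n)"
  define \<delta> where "\<delta> = 1 + B * int n"
  \<comment> \<open>This makes \<open>\<delta>\<close> positive, so that \<open>\<delta>^2\<close>
    can be cancelled at the end.\<close>
  have "B \<ge> 0" using b by (simp add: B_def power_mult)
  then have "\<delta> > 0" by (simp add: \<delta>_def add_pos_nonneg)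
  obtain n' where n': "n = n' + 1" using n by (metis add.commute le_Suc_ex numeral_3_eq_3 plus_1_eq_Suc Suc_le_D)
  obtain e where e: "(int n + 1 - \<delta>) ^ (n' + 2) =
      (int n + 1) ^ (n' + 2) - int (n' + 2) * \<delta> * (int n + 1) ^ (n' + 1) + \<delta>\<^sup>2 * e" "p ^ n' dvd e"
    using power_diff_high_divisibility dvd unfolding B_def[symmetric] \<delta>_def[symmetric] by blast
  have idx: "n' + 2 = n + 1" "n' + 1 = n" "int (n' + 2) = int n + 1" using n' by auto
  have "int n * (\<D> n b m * \<delta>\<^sup>2) = (int n + 1 - \<delta>) ^ (n + 1) + (\<delta> - 1) * (int n + 1) ^ (n + 1)"
  proof -
    have "int n * (\<D> n b m * \<delta>\<^sup>2) =
        int n * (int n ^ n * (1 - B) ^ (n + 1) + B * (int n + 1) ^ (n + 1))"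
      unfolding B_def \<delta>_def using n by (subst \<D>_mult_denominator) simp_all
    also have "\<dots> = (int n * (1 - B)) ^ (n + 1) + int n * B * (int n + 1) ^ (n + 1)"
      by (simp add: power_mult_distrib distrib_left mult.assoc)
    also have "int n * (1 - B) = int n + 1 - \<delta>" by (simp add: \<delta>_def algebra_simps)
    also have "int n * B = \<delta> - 1" by (simp add: \<delta>_def)
    finally show ?thesis .
  qed
  also have "\<dots> = \<delta>\<^sup>2 * e"
    unfolding e(1)[unfolded idx] by (simp add: algebra_simps)
  finally have "\<delta>\<^sup>2 * (int n * \<D> n b m) = \<delta>\<^sup>2 * e" by (simp only: mult_ac)
  then have "int n * \<D> n b m = e" using \<open>\<delta> > 0\<close> by simp
  moreover have "p\<^sup>2 dvd p ^ n'" using n n' by (intro le_imp_power_dvd) simp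
  ultimately have "p\<^sup>2 dvd int n * \<D> n b m" using e(2) dvd_trans by blast
  moreover have "\<not> p dvd int n" using dvd(1) p by (metis dvd_add_right_iff not_prime_unit)
  then have "algebraic_semidom_class.coprime (p\<^sup>2) (int n)" using p by (simp add: prime_imp_coprime)
  ultimately show ?thesis by (simp add: coprime_dvd_mult_right_iff)
qed

text \<open>\<open>l\<close> is the factor of the derivative of the trinomial in \<open>y\<close>
  that vanishes at its critical point. The scaling lets \<open>y\<close> enter only through
  \<open>M * of_nat (Suc n) * y\<close>, avoiding division; in the expansion in \<open>l\<close> the
  linear terms cancel, and the constant is minus the numerator of \<open>\<D>\<close>.\<close>

lemma trinomial_at_critical_point:
  fixes M U B y l :: "'a :: comm_ring_1"
  assumes n: "n > 0" and l: "M * of_nat (Suc n) * y = of_nat n * U + l"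
  obtains e where "M ^ n * of_nat (Suc n) ^ Suc n * (M * y ^ Suc n - U * y ^ n - B) =
    l * l * e - (of_nat n ^ n * U ^ Suc n + B * M ^ n * of_nat (Suc n) ^ Suc n)"
proof -
  define C :: 'a where "C = of_nat (Suc n)"
  define N :: 'a where "N = of_nat n"
  have C: "C = N + 1" by (simp add: C_def N_def)
  define a where "a = N * U"
  obtain e1 where e1: "(a + l) ^ Suc n = a ^ Suc n + C * a ^ n * l + l\<^sup>2 * e1"
    using power_add_mod_square[of a l "Suc n"] unfolding C_def by auto
  obtain e2 where e2: "(a + l) ^ n = a ^ n + N * a ^ (n - 1) * l + l\<^sup>2 * e2"
    using power_add_mod_square[of a l n] unfolding N_def by auto
  have an: "a ^ n = a * a ^ (n - 1)" using n by (cases n) auto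
  have ring: "M ^ n * C ^ Suc n * (M * y ^ Suc n - U * y ^ n - B) =
      (M * C * y) ^ Suc n - U * C * (M * C * y) ^ n - B * M ^ n * C ^ Suc n"
    by (simp add: power_mult_distrib algebra_simps)
  have ring2: "x * a + C * x * l + l\<^sup>2 * e1 - U * C * (x + N * z * l + l\<^sup>2 * e2) - w =
      x * (a - U * C) + C * l * (x - N * U * z) + l * l * (e1 - U * C * e2) - w" for x z w
    by (simp add: algebra_simps power2_eq_square)
  have "a ^ n * (a - U * C) = - (N ^ n * U ^ Suc n)"
    unfolding a_def C power_mult_distrib by (simp add: algebra_simps)
  moreover have "a ^ n - N * U * a ^ (n - 1) = 0" using an unfolding a_def by simp
  ultimately have "(a + l) ^ Suc n - U * C * (a + l) ^ n - B * M ^ n * C ^ Suc n =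
      l * l * (e1 - U * C * e2) - (N ^ n * U ^ Suc n + B * M ^ n * C ^ Suc n)"
    unfolding e1 e2 unfolding power_Suc2 ring2 by simp
  then show thesis
    using that l ring unfolding C_def[symmetric] N_def[symmetric] a_def[symmetric] by metis
qed

context prime_ideal2
begin

text \<open>The trinomial \<open>T\<close> lies in \<open>J2\<close>, so its derivative puts
  \<open>l\<close> in \<open>J\<close>, and the critical value gives \<open>p^2\<close> dividing
  \<open>\<D> \<delta>^2\<close>. Hence \<open>p\<close> divides \<open>\<delta>\<close> but not
  \<open>n + 1\<close>, and \<open>l\<close> forces \<open>M * y - 1\<close> into \<open>J\<close>.
  Then \<open>T\<close> vanishes to third order, and its second derivative yields the
  contradiction.\<close>

lemma poly_F_notin_J2_if_coprime:
  assumes pb: "\<not> p dvd b" and pm: "\<not> p dvd m" and pk: "\<not> p dvd int k"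
    and k: "k > 0" and n: "n \<ge> 3" and b: "b \<ge> 0" and D: "\<not> p\<^sup>2 dvd \<D> n b m"
  shows "poly_F n b m k \<notin> J2"
proof
  assume F: "poly_F n b m k \<in> J2"
  define y where "y = (monom 1 k :: int poly)"
  define M where "M = [:m\<^sup>2:]"
  define u where "u = 1 - b * m ^ (2 * n)"
  define U where "U = [:u:]"
  define C where "C = [:int n + 1:]"
  define N where "N = [:int n:]"
  define l where "l = M * C * y - N * U"
  define T where "T = M * y ^ Suc n - U * y ^ n - [:b:]"
  define \<delta> where "\<delta> = 1 + b * m ^ (2 * n) * int n"
  have C_nat: "C = of_nat (Suc n)" and N_nat: "N = of_nat n"
    by (simp_all add: C_def N_def of_nat_poly)
  have T: "T = (M * y - 1) * poly_F n b m k"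
    unfolding T_def M_def U_def u_def y_def by (rule geometric_poly_F[symmetric])
  have TJ2: "T \<in> J2" unfolding T by (rule ideal2_sq_mult[OF F])
  have B: "[:b:] \<notin> J" using pb const_in_J_iff by blast
  have MJ: "M \<notin> J" using pm p const_in_J_iff unfolding M_def by (metis prime_dvd_power)
  obtain n' where n': "n = Suc n'" using n by (cases n) auto
  \<comment> \<open>If \<open>y\<close> were in \<open>J\<close>, the trinomial would leave its
    constant term \<open>b\<close> in \<open>J\<close>.\<close>
  have y: "y \<notin> J"
  proof
    assume "y \<in> J"
    have "[:b:] = M * y ^ Suc n - U * y ^ n - T" by (simp add: T_def)
    also have "\<dots> = y * (M * y ^ n) - y * (U * y ^ n') - T"
      unfolding n' power_Suc by (simp only: mult_ac)
    also have "\<dots> \<in> J" by (intro ideal2_diff ideal2_mult' \<open>y \<in> J\<close> ideal2_sq_subset TJ2)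
    finally show False using B by blast
  qed
  have y': "pderiv y \<notin> J"
  proof -
    have "pderiv y = [:int k:] * monom 1 (k - 1)" by (simp add: y_def pderiv_monom smult_monom)
    moreover have "monom 1 (k - 1) \<notin> J"
    proof
      assume "monom 1 (k - 1) \<in> J"
      then have "monom 1 (k - 1) * monom 1 1 \<in> J" by (rule ideal2_mult')
      then show False using y k by (simp add: y_def mult_monom)
    qed
    ultimately show ?thesis using pk const_in_J_iff by (metis mult_in_J_iff)
  qed
  have pd_const: "pderiv ([:c:] * q) = [:c:] * pderiv q" for c q by (simp add: pderiv_smult)
  have pd_pow: "pderiv (y ^ Suc j) = of_nat (Suc j) * y ^ j * pderiv y" for j
    by (simp add: pderiv_power_Suc of_nat_poly del: of_nat_Suc power_Suc)
  have T': "pderiv T = y ^ n' * pderiv y * l"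
  proof -
    have "pderiv T = M * (C * y ^ n * pderiv y) - U * (N * y ^ n' * pderiv y)"
      unfolding T_def pderiv_diff M_def U_def pd_const pd_pow unfolding n' pd_pow
      unfolding n'[symmetric] C_nat N_nat by simp
    also have "\<dots> = y ^ n' * pderiv y * l"
      unfolding l_def n' power_Suc by (simp only: right_diff_distrib mult_ac)
    finally show ?thesis .
  qed
  have l: "l \<in> J"
    using pderiv_ideal_sq[OF TJ2] y y' power_in_J unfolding T' by (metis mult_in_J_iff)
  have num: "[:\<D> n b m * \<delta>\<^sup>2:] \<in> J2"
  proof -
    have "M * of_nat (Suc n) * y = of_nat n * U + l"
      unfolding l_def C_nat[symmetric] N_nat[symmetric] by simp
    then obtain e where e: "M ^ n * C ^ Suc n * T = l * l * e - (N ^ n * U ^ Suc n + [:b:] * M ^ n * C ^ Suc n)"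
      using trinomial_at_critical_point[of n M y U l "[:b:]"] n unfolding T_def C_nat N_nat by auto
    have "[:\<D> n b m * \<delta>\<^sup>2:] = N ^ n * U ^ Suc n + [:b:] * M ^ n * C ^ Suc n"
    proof -
      have "M ^ n = [:m ^ (2 * n):]" unfolding M_def by (simp only: poly_const_pow power_mult)
      moreover have "\<D> n b m * \<delta>\<^sup>2 = int n ^ n * u ^ Suc n + b * m ^ (2 * n) * (int n + 1) ^ Suc n"
        using \<D>_mult_denominator[of n b m] n by (simp add: u_def \<delta>_def)
      ultimately show ?thesis unfolding N_def U_def C_def poly_const_pow by simp
    qed
    also have "\<dots> = e * (l * l) - M ^ n * C ^ Suc n * T" unfolding e by (simp add: mult_ac)
    also have "\<dots> \<in> J2" by (intro ideal2_sq_diff ideal2_sq_mult ideal2_mult_sq l TJ2)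
    finally show ?thesis .
  qed
  then have num_dvd: "p\<^sup>2 dvd \<D> n b m * \<delta>\<^sup>2" by (rule const_in_J2)
  have \<delta>: "\<delta> = (int n + 1) - int n * u" by (simp add: \<delta>_def u_def algebra_simps)
  have "p dvd \<delta>"
  proof (rule ccontr)
    assume "\<not> p dvd \<delta>"
    then have "algebraic_semidom_class.coprime (p\<^sup>2) (\<delta>\<^sup>2)" using p by (simp add: prime_imp_coprime)
    then show False using num_dvd D by (simp add: coprime_dvd_mult_left_iff)
  qed
  have pc: "\<not> p dvd int n + 1"
    using prime_square_dvd_\<D>[OF p n b _ \<open>p dvd \<delta>\<close>[unfolded \<delta>_def]] D by blast
  have "l = C * (M * y - 1) + [:\<delta>:]"
  proof -
    have "[:\<delta>:] = C - N * U" by (simp add: \<delta> C_def N_def U_def)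
    moreover have "M * C * y - NU = C * (M * y - 1) + (C - NU)" for NU by (simp add: algebra_simps)
    ultimately show ?thesis unfolding l_def by simp
  qed
  then have "C * (M * y - 1) = l - [:\<delta>:]" by simp
  also have "\<dots> \<in> J" using l \<open>p dvd \<delta>\<close> const_in_J_iff by (intro ideal2_diff) blast+
  finally have q: "M * y - 1 \<in> J" using pc const_in_J_iff unfolding C_def by (metis mult_in_J_iff)
  have FJ: "poly_F n b m k \<in> J" and F'J: "pderiv (poly_F n b m k) \<in> J"
    using F by (auto intro: ideal2_sq_subset pderiv_ideal_sq)
  \<comment> \<open>Each term of the second derivative of \<open>(M * y - 1) * F\<close> keeps a
    factor in \<open>J\<close>. Computed from \<open>T'\<close> instead, it is, up to a multiple of
    \<open>l\<close>, a product of elements outside \<open>J\<close>.\<close>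
  have "pderiv (pderiv T) \<in> J"
    unfolding T pderiv_mult pderiv_add
    by (intro ideal2_add ideal2_mult' ideal2_mult[OF F'J] F'J FJ q)
  moreover have "pderiv (pderiv T) = y ^ n' * pderiv y * (M * C * pderiv y) + l * pderiv (y ^ n' * pderiv y)"
  proof -
    have "pderiv l = M * C * pderiv y"
      unfolding l_def pderiv_diff M_def C_def N_def U_def mult.assoc pd_const by simp
    then show ?thesis unfolding T' pderiv_mult[of _ l] by simp
  qed
  ultimately have "y ^ n' * pderiv y * (M * C * pderiv y) + l * pderiv (y ^ n' * pderiv y) \<in> J" by simp
  then have "y ^ n' * pderiv y * (M * C * pderiv y) \<in> J"
    using ideal2_diff[OF _ ideal2_mult'[OF l]] by (metis add_diff_cancel_right')
  moreover have "C \<notin> J" using pc const_in_J_iff unfolding C_def by blast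
  ultimately show False using y y' MJ power_in_J by (metis mult_in_J_iff)
qed

end

section \<open>The Wieferich condition and the main theorem\<close>

text \<open>The product divided out involves only primes of \<open>b * m\<close>, so the full power
  of \<open>p\<close> survives in the squarefree quotient.\<close>

lemma prime_square_not_dvd_\<D>:
  assumes sf: "squarefree (reduced_\<D> n b m)" and bm: "b * m \<noteq> 0"
    and p: "prime p" "\<not> p dvd b * m"
  shows "\<not> p\<^sup>2 dvd \<D> n b m"
proof
  assume dvd: "p\<^sup>2 dvd \<D> n b m"
  define A where "A = {p :: int. prime p \<and> p dvd b * m}"
  define P where "P = (\<Prod>q\<in>A. q ^ multiplicity q (\<D> n b m))"
  have "finite A" unfolding A_def using finite_prime_divisors[OF bm] by simp
  then have "P \<noteq> 0" unfolding P_def by (auto simp: A_def)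
  have "rat_of_int (reduced_\<D> n b m) = of_int \<bar>\<D> n b m\<bar> / of_int P"
    unfolding P_def A_def by (rule of_int_reduced_\<D>[OF bm])
  then have "rat_of_int (reduced_\<D> n b m * P) = of_int \<bar>\<D> n b m\<bar>"
    using \<open>P \<noteq> 0\<close> by simp
  then have eq: "reduced_\<D> n b m * P = \<bar>\<D> n b m\<bar>" by (simp only: of_int_eq_iff)
  have "algebraic_semidom_class.coprime p q" if "q \<in> A" for q
    using that p by (intro primes_coprime) (auto simp: A_def)
  then have "algebraic_semidom_class.coprime (p\<^sup>2) P"
    unfolding P_def by (intro prod_coprime_right) simp
  moreover have "p\<^sup>2 dvd reduced_\<D> n b m * P" unfolding eq using dvd by simp
  ultimately have "p\<^sup>2 dvd reduced_\<D> n b m" by (simp add: coprime_dvd_mult_left_iff)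
  then have "p dvd 1" using sf unfolding squarefree_def by blast
  then show False using p(1) by (metis not_prime_unit)
qed

text \<open>For odd \<open>q\<close> the sign comes out of the power, leaving
  \<open>-b (b^(q-1) - 1)\<close> with \<open>b\<close> prime to \<open>q\<close>.\<close>

lemma wieferich_prime_iff_odd:
  assumes q: "prime q" "odd q" and b: "\<not> int q dvd b"
  shows "(int q)\<^sup>2 dvd (- b) ^ q + b \<longleftrightarrow> wieferich_prime b q"
proof -
  have "q > 0" using q(1) by (rule prime_gt_0_nat)
  then have "(- b) ^ q + b = - (b * (b ^ (q - 1) - 1))"
    using q(2) by (cases q) (simp_all add: algebra_simps)
  then have "(int q)\<^sup>2 dvd (- b) ^ q + b \<longleftrightarrow> (int q)\<^sup>2 dvd b * (b ^ (q - 1) - 1)" by simp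
  also have "algebraic_semidom_class.coprime ((int q)\<^sup>2) b"
    using q(1) b by (simp add: prime_imp_coprime)
  then have "(int q)\<^sup>2 dvd b * (b ^ (q - 1) - 1) \<longleftrightarrow> (int q)\<^sup>2 dvd b ^ (q - 1) - 1"
    by (rule coprime_dvd_mult_right_iff)
  also have "\<dots> \<longleftrightarrow> wieferich_prime b q"
    using q(1) by (simp add: wieferich_prime_def cong_iff_dvd_diff)
  finally show ?thesis .
qed

text \<open>At the prime 2 the even power loses the sign and \<open>b (b + 1)\<close> appears in
  place of \<open>b (b - 1)\<close>. This reverses the Wieferich condition, which is why 2 is
  treated separately.\<close>

lemma four_dvd_square_add_iff:
  fixes b :: int
  assumes "odd b"
  shows "4 dvd (- b)\<^sup>2 + b \<longleftrightarrow> \<not> [b = 1] (mod 4)"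
proof -
  have "(- b)\<^sup>2 + b = b * (b + 1)" by (simp add: power2_eq_square algebra_simps)
  moreover have "algebraic_semidom_class.coprime (2\<^sup>2) b"
    using assms by (simp only: coprime_power_left_iff coprime_left_2_iff_odd) simp
  then have "4 dvd b * (b + 1) \<longleftrightarrow> 4 dvd b + 1" by (simp add: coprime_dvd_mult_right_iff)
  moreover have "4 dvd b + 1 \<longleftrightarrow> \<not> [b = 1] (mod 4)" using assms unfolding cong_def by presburger
  ultimately show ?thesis by simp
qed

lemma prime_dvd_rad:
  assumes "prime q" "q dvd k" "k > 0"
  shows "q dvd rad k"
  unfolding rad_def using assms by (intro dvd_prodI) (auto simp: in_prime_factors_iff)

theorem theorem1p5:
  fixes n k :: nat and m b :: int
  assumes "n \<ge> 3" and "\<bar>m\<bar> \<ge> 2" and "b \<ge> 2" and "k \<ge> 2"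
    and "gcd b m = 1"
    and "squarefree b"
    and "[m = 0] (mod int (rad k))"
    and "squarefree (reduced_\<D> n b m)"
    and "\<And>p. prime p \<Longrightarrow> p dvd k \<Longrightarrow> poly_mod.irreducible_m (int p) (poly_g n b k p)"
  shows "monogenic (poly_F n b m k) \<longleftrightarrow>
    (\<forall>p. prime p \<and> odd p \<and> int p dvd int k * gcd (int n) m \<longrightarrow> \<not> wieferich_prime b p) \<and>
    ([int k * gcd (int n) m = 0] (mod 2) \<longrightarrow> [b = 1] (mod 4))"
proof -
  let ?c = "int k * gcd (int n) m"
  have pos: "n > 0" "k > 0" using assms(1,4) by auto
  have rad_m: "int (rad k) dvd m" using assms(7) by (simp add: cong_0_iff)
  \<comment> \<open>The radical hypothesis makes every prime of \<open>k\<close>, hence every prime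
    of \<open>?c\<close>, divide \<open>m\<close>.\<close>
  have k_m: "int q dvd m" if "prime q" "q dvd k" for q
    using prime_dvd_rad[OF that pos(2)] rad_m by (metis dvd_trans int_dvd_int_iff)
  have c_cases: "int q dvd int k \<or> int q dvd gcd (int n) m" if "prime q" "int q dvd ?c" for q
  proof -
    have "prime (int q)" using that(1) by simp
    then show ?thesis using that(2) by (rule prime_dvd_multD)
  qed
  have c_m: "int q dvd m" if "prime q" "int q dvd ?c" for q
    using c_cases[OF that] k_m[OF that(1)] by auto
  have not_dvd_b: "\<not> r dvd b" if "prime r" "r dvd m" for r
    using that assms(5) by (metis gcd_greatest not_prime_unit)
  \<comment> \<open>A condition uniform in \<open>q\<close>; the different signs at odd primes and
    at 2 enter only afterwards.\<close>
  have key: "monogenic (poly_F n b m k) \<longleftrightarrow>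
    (\<forall>q. prime q \<and> int q dvd ?c \<longrightarrow> \<not> (int q)\<^sup>2 dvd (- b) ^ q + b)"
  proof
    assume mono: "monogenic (poly_F n b m k)"
    show "\<forall>q. prime q \<and> int q dvd ?c \<longrightarrow> \<not> (int q)\<^sup>2 dvd (- b) ^ q + b"
    proof (intro allI impI notI)
      fix q assume q: "prime q \<and> int q dvd ?c" and sq: "(int q)\<^sup>2 dvd (- b) ^ q + b"
      have qm: "int q dvd m" using c_m q by blast
      have "int q dvd int k \<or> int q dvd gcd (int n) m" using q c_cases by blast
      then have "q dvd n * k" by auto
      then obtain N where N: "n * k = q * N" by auto
      then have "N > 0" using pos by (cases N) auto
      then have deg: "degree (monom 1 N + [:b:]) = N"
        by (subst degree_add_eq_left) (simp_all add: degree_monom_eq)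
      have "poly_F n b m k \<in> ideal2_sq [:int q:] (monom 1 N + [:b:])"
        unfolding poly_F_in_ideal_sq_iff[OF qm pos(1)] N by (rule binomial_in_ideal_sq[OF sq])
      moreover have "lead_coeff (monom 1 N + [:b:]) = 1"
        unfolding deg using \<open>N > 0\<close> by (simp add: coeff_eq_0)
      ultimately have "\<not> monogenic (poly_F n b m k)"
        using q \<open>N > 0\<close> deg by (intro not_monogenic_if_ideal_sq[of "int q" "monom 1 N + [:b:]"]) auto
      then show False using mono by blast
    qed
  next
    assume cond: "\<forall>q. prime q \<and> int q dvd ?c \<longrightarrow> \<not> (int q)\<^sup>2 dvd (- b) ^ q + b"
    show "monogenic (poly_F n b m k)"
    proof (rule monogenicI_ideal_sq)
      show "lead_coeff (poly_F n b m k) = 1" using pos by (rule degree_poly_F(2)[rotated])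
      show "irreducible (map_poly rat_of_int (poly_F n b m k))"
        using assms(3,6) pos by (intro irreducible_poly_F)
      fix p :: int and g :: "int poly"
      assume "prime p" "lead_coeff g = 1" "degree g > 0"
        "\<forall>r s. r * s \<in> ideal2 [:p:] g \<longrightarrow> r \<in> ideal2 [:p:] g \<or> s \<in> ideal2 [:p:] g"
      then interpret prime_ideal2 p g by unfold_locales
      define q where "q = nat p"
      have pq: "p = int q" using p prime_ge_0_int[of p] by (simp add: q_def)
      have q: "prime q" using p by (simp add: pq)
      \<comment> \<open>These are the three kinds of primes, each met by its own argument against
        membership in \<open>J2\<close>.\<close>
      consider "p dvd b" | "p dvd m" | "\<not> p dvd b" "\<not> p dvd m" by blast
      then show "poly_F n b m k \<notin> ideal2_sq [:p:] g"
      proof cases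
        case 1
        have "\<not> p\<^sup>2 dvd b" using assms(6) p unfolding squarefree_def by (metis not_prime_unit)
        then show ?thesis using poly_F_notin_J2_if_dvd_b 1 assms(1) by simp
      next
        case 2
        have nb: "\<not> p dvd b" using not_dvd_b p 2 by blast
        show ?thesis
        proof
          assume "poly_F n b m k \<in> J2"
          then have "monom 1 (n * k) + [:b:] \<in> J2"
            using poly_F_in_ideal_sq_iff[OF 2 pos(1)] by blast
          moreover have "b \<ge> 0" "n * k > 0" using assms(3) pos by auto
          ultimately have *: "q dvd n * k" "p\<^sup>2 dvd (- b) ^ q + b"
            using binomial_in_J2[OF pq nb] by blast+
          have "q dvd n \<or> q dvd k" using q *(1) by (rule prime_dvd_multD)
          \<comment> \<open>If \<open>q\<close> divides \<open>n\<close>, it divides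
            \<open>gcd (int n) m\<close>, since it divides \<open>m\<close> in this case.\<close>
          then have "int q dvd ?c" using 2 unfolding pq by auto
          then show False using cond *(2) q unfolding pq by blast
        qed
      next
        case 3
        have "\<not> p dvd int k" using k_m[OF q] 3(2) unfolding pq by auto
        moreover have "\<not> p\<^sup>2 dvd \<D> n b m"
        proof (rule prime_square_not_dvd_\<D>[OF assms(8) _ p])
          show "b * m \<noteq> 0" using assms(2,3) by auto
          show "\<not> p dvd b * m" using 3 p by (simp add: prime_dvd_mult_iff)
        qed
        ultimately show ?thesis
          using poly_F_notin_J2_if_coprime 3 pos assms(1,3) by simp
      qed
    qed
  qed
  have odd_iff: "(int q)\<^sup>2 dvd (- b) ^ q + b \<longleftrightarrow> wieferich_prime b q"
    if "prime q" "odd q" "int q dvd ?c" for q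
    using that c_m[OF that(1,3)] not_dvd_b[of "int q"] by (intro wieferich_prime_iff_odd) auto
  have two_iff: "(int 2)\<^sup>2 dvd (- b) ^ 2 + b \<longleftrightarrow> \<not> [b = 1] (mod 4)" if "int 2 dvd ?c"
    using c_m[OF two_is_prime_nat that] not_dvd_b[of 2] four_dvd_square_add_iff[of b] by simp
  have two_c: "[?c = 0] (mod 2) \<longleftrightarrow> int 2 dvd ?c" by (simp add: cong_0_iff)
  show ?thesis
    unfolding key two_c
  proof (intro iffI conjI allI impI)
    fix q assume "\<forall>q. prime q \<and> int q dvd ?c \<longrightarrow> \<not> (int q)\<^sup>2 dvd (- b) ^ q + b"
      "prime q \<and> odd q \<and> int q dvd ?c"
    then show "\<not> wieferich_prime b q" using odd_iff[of q] by blast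
  next
    assume "\<forall>q. prime q \<and> int q dvd ?c \<longrightarrow> \<not> (int q)\<^sup>2 dvd (- b) ^ q + b" "int 2 dvd ?c"
    from this(1) two_is_prime_nat this(2) have "\<not> (int 2)\<^sup>2 dvd (- b) ^ 2 + b" using two_is_prime_nat by blast
    then show "[b = 1] (mod 4)" using two_iff \<open>int 2 dvd ?c\<close> by blast
  next
    fix q
    assume rhs: "(\<forall>p. prime p \<and> odd p \<and> int p dvd ?c \<longrightarrow> \<not> wieferich_prime b p) \<and>
      (int 2 dvd ?c \<longrightarrow> [b = 1] (mod 4))" and q: "prime q \<and> int q dvd ?c"
    show "\<not> (int q)\<^sup>2 dvd (- b) ^ q + b"
    proof (cases "odd q")
      case True
      then show ?thesis using odd_iff[of q] rhs q by blast
    next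
      case False
      then have "q = 2" using q by (metis primes_dvd_imp_eq two_is_prime_nat)
      then show ?thesis using two_iff rhs q by blast
    qed
  qed
qed

end
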